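(* Let $s$ be a positive integer and let $\Delta\subset\mathbb{R}^{4s-2}$ be a lattice simplex of dimension $4s-2$ with $\deg(\Delta)=s$ which is not a lattice pyramid. Then $s=2^r$ for some integer $r\ge 0$, and $\Delta$ is unimodularly equivalent to $\Delta(r+2)$; equivalently, for a suitable ordering of the vertices of $\Delta$ one has $\Lambda_\Delta=B(r+2)$. In particular $\Delta$ is uniquely determined by $r$ up to unimodular equivalence.
   Context: A lattice polytope is a convex polytope in $\mathbb{R}^d$ with vertices in $\mathbb{Z}^d$. Two lattice polytopes $P,P'\subset\mathbb{R}^d$ are unimodularly equivalent if $P'=f(P)+u$ for some $f\in \mathrm{GL}_d(\mathbb{Z})$, $u\in\mathbb{Z}^d$. For a $d$-dimensional lattice polytope $P$, $\sum_{n\ge0}|nP\cap\mathbb{Z}^d|t^n=h^*_P(t)/(1-t)^{d+1}$ with $h^*_P$ a polynomial; $\deg(P)$ denotes the degree of $h^*_P$ (equivalently $d+1-\min\{m: mP^\circ\cap\mathbb{Z}^d\neq\emptyset\}$). The lattice pyramid over a lattice polytope $Q\subset\mathbb{R}^{k}$ is $\mathrm{conv}(\{(\alpha,0):\alpha\in Q\}\cup\{(0,\dots,0,1)\})\subset\mathbb{R}^{k+1}$; a polytope "is a lattice pyramid" if it is unimodularly equivalent to a lattice pyramid over a lower-dimensional lattice polytope. For a $d$-dimensional lattice simplex $\Delta\subset\mathbb{R}^d$ with ordered vertices $v_1,\dots,v_{d+1}$, define the finite abelian group $\Lambda_\Delta=\{(x_1,\dots,x_{d+1})\in(\mathbb{R}/\mathbb{Z})^{d+1}: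 \sum_i x_iv_i\in\mathbb{Z}^d,\ \sum_i x_i\in\mathbb{Z}\}$ with coordinatewise addition. (Unimodular equivalence classes of $d$-simplices with ordered vertices correspond bijectively to finite subgroups of $(\mathbb{R}/\mathbb{Z})^{d+1}$ all of whose elements have integer coordinate sum.) For $r\ge1$, let $A(r)\in\mathbb{F}_2^{r\times(2^r-1)}$ be a matrix whose columns are all the nonzero vectors of $\mathbb{F}_2^r$ (each exactly once), and let $M(r)\in\{0,1/2\}^{r\times(2^r-1)}$ be obtained from $A(r)$ by replacing each entry $1$ by $1/2$. Let $B(r)\subset(\mathbb{R}/\mathbb{Z})^{2^r-1}$ be the subgroup generated by the rows of $M(r)$ (it arises from the $r$-dimensional binary simplex code). Every nonzero element of $B(r+2)$ has exactly $2^{r+1}$ nonzero coordinates, so all coordinate sums are integers, and $\Delta(r+2)$ denotes a lattice simplex of dimension $2^{r+2}-2$ with $\Lambda_{\Delta(r+2)}=B(r+2)$ (unique up to unimodular equivalence). *)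

theory Defs
  imports
    "HOL-Analysis.Analysis"
    "HOL-Computational_Algebra.Polynomial_FPS"
    "HOL-Computational_Algebra.Group_Closure"
    "HOL-Library.Function_Algebras"
    "HOL-Library.Z2"
begin

section \<open>Lattice polytopes\<close>

definition integer_lattice :: "(real ^ 'n) set" where
  "integer_lattice = {x. \<forall>i. x $ i \<in> \<int>}"

definition lattice_polytope :: "(real ^ 'n) set \<Rightarrow> bool" where
  "lattice_polytope P \<longleftrightarrow>
     polytope P \<and> (\<forall>v. v extreme_point_of P \<longrightarrow> v \<in> integer_lattice)"

text \<open>Full-dimensional lattice simplices.\<close>

definition lattice_simplex :: "(real ^ 'n) set \<Rightarrow> bool" where
  "lattice_simplex \<Delta> \<longleftrightarrow> int CARD('n) simplex \<Delta> \<and> lattice_polytope \<Delta>"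

text \<open>An integer matrix that is \<^const>\<open>invertible\<close> over the integers is an element of
  \<open>GL\<^sub>d(\<int>)\<close>.\<close>

definition unimodularly_equivalent :: "(real ^ 'n) set \<Rightarrow> (real ^ 'n) set \<Rightarrow> bool" where
  "unimodularly_equivalent P P' \<longleftrightarrow>
     (\<exists>(A :: int ^ 'n ^ 'n) u. invertible A \<and> u \<in> integer_lattice \<and>
        P' = (\<lambda>x. map_matrix real_of_int A *v x + u) ` P)"

text \<open>The space \<open>\<real>\<^sup>d\<^sup>-\<^sup>1 \<times> 0\<close> is the coordinate hyperplane \<open>x $ k = 0\<close>, the \<open>k\<close>-th coordinate
  playing the role of the last one; a polytope in this hyperplane is a lattice polytope there iff
  it is one in the whole space.  The index type carries no order, so any \<open>k\<close> may be chosen;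
  different choices differ by a permutation of coordinates, which is unimodular.\<close>

definition lattice_pyramid_over :: "'n \<Rightarrow> (real ^ 'n) set \<Rightarrow> (real ^ 'n) set" where
  "lattice_pyramid_over k Q = convex hull (Q \<union> {axis k 1})"

definition is_lattice_pyramid :: "(real ^ 'n) set \<Rightarrow> bool" where
  "is_lattice_pyramid P \<longleftrightarrow>
     (\<exists>k Q. lattice_polytope Q \<and> Q \<subseteq> {x. x $ k = 0} \<and>
        unimodularly_equivalent P (lattice_pyramid_over k Q))"


section \<open>The \<open>h\<^sup>*\<close>-polynomial\<close>

definition ehrhart_series :: "(real ^ 'n) set \<Rightarrow> int fps" where
  "ehrhart_series P =
     Abs_fps (\<lambda>n. int (card ((\<lambda>x. real n *\<^sub>R x) ` P \<inter> integer_lattice)))"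

definition h_star :: "(real ^ 'n) set \<Rightarrow> int poly" where
  "h_star P =
     (THE h. fps_of_poly h = ehrhart_series P * (1 - fps_X) ^ nat (aff_dim P + 1))"

lemma h_star_eqI:
  assumes "fps_of_poly h = ehrhart_series P * (1 - fps_X) ^ nat (aff_dim P + 1)"
  shows "h_star P = h"
  unfolding h_star_def using assms by (metis (mono_tags, lifting) fps_of_poly_eq_iff the_equality)

definition polytope_degree :: "(real ^ 'n) set \<Rightarrow> nat" where
  "polytope_degree P = degree (h_star P)"


section \<open>The group of a lattice simplex\<close>

quotient_type real_mod_int = real / "\<lambda>x y. x - y \<in> \<int>"
proof (rule equivpI)
  show "reflp (\<lambda>x y :: real. x - y \<in> \<int>)"
    by (simp add: reflp_def)
  show "symp (\<lambda>x y :: real. x - y \<in> \<int>)"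
    unfolding symp_def by (metis Ints_minus minus_diff_eq)
  show "transp (\<lambda>x y :: real. x - y \<in> \<int>)"
    unfolding transp_def by (metis Ints_add diff_add_cancel add_diff_eq)
qed

instantiation real_mod_int :: ab_group_add
begin

lift_definition zero_real_mod_int :: real_mod_int is 0 .

lift_definition plus_real_mod_int :: "real_mod_int \<Rightarrow> real_mod_int \<Rightarrow> real_mod_int" is "(+)"
  by (metis Ints_add add_diff_add)

lift_definition uminus_real_mod_int :: "real_mod_int \<Rightarrow> real_mod_int" is uminus
  by (metis Ints_minus minus_diff_minus)

lift_definition minus_real_mod_int :: "real_mod_int \<Rightarrow> real_mod_int \<Rightarrow> real_mod_int" is "(-)"
  by (metis Ints_diff diff_diff_eq2 diff_diff_add add.commute diff_add_eq)

instance
  by standard (transfer; simp)+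

end

lift_definition real_class :: "real \<Rightarrow> real_mod_int" is "\<lambda>x. x" .

definition vertex_ordering :: "(real ^ 'n) set \<Rightarrow> (real ^ 'n) list \<Rightarrow> bool" where
  "vertex_ordering \<Delta> vs \<longleftrightarrow> distinct vs \<and> set vs = {v. v extreme_point_of \<Delta>}"

text \<open>Elements of \<open>(\<real>/\<int>)\<^sup>m\<close> are functions on \<open>nat\<close> that vanish at all arguments \<open>\<ge> m\<close>;
  coordinates are numbered from \<open>0\<close>.  The two integrality conditions on a tuple of classes are
  expressed through a real representative \<open>x\<close>; as the vertices are lattice points, they do
  not depend on the representative.\<close>

definition simplex_group :: "(real ^ 'n) list \<Rightarrow> (nat \<Rightarrow> real_mod_int) set" where
  "simplex_group vs =
     {(\<lambda>i. real_class (x i)) | x :: nat \<Rightarrow> real.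
        (\<forall>i \<ge> length vs. x i = 0) \<and>
        (\<Sum>i<length vs. x i *\<^sub>R vs ! i) \<in> integer_lattice \<and>
        (\<Sum>i<length vs. x i) \<in> \<int>}"


section \<open>Binary simplex codes\<close>

text \<open>\<open>A\<close>, with rows \<open>i < r\<close> and columns \<open>j < 2 ^ r - 1\<close>, has every nonzero vector of
  \<open>\<bbbF>\<^sub>2\<^sup>r\<close> as a column exactly once; entries outside this range are irrelevant.\<close>

definition simplex_code_matrix :: "nat \<Rightarrow> (nat \<Rightarrow> nat \<Rightarrow> bit) \<Rightarrow> bool" where
  "simplex_code_matrix r A \<longleftrightarrow>
     bij_betw (\<lambda>j. map (\<lambda>i. A i j) [0..<r]) {..<2 ^ r - 1}
       {c. length c = r \<and> c \<noteq> replicate r 0}"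

definition half_row :: "nat \<Rightarrow> (nat \<Rightarrow> nat \<Rightarrow> bit) \<Rightarrow> nat \<Rightarrow> (nat \<Rightarrow> real_mod_int)" where
  "half_row r A i =
     (\<lambda>j. if j < 2 ^ r - 1 \<and> A i j = 1 then real_class (1 / 2) else 0)"

text \<open>The group \<open>B(r)\<close> obtained from the matrix \<open>A = A(r)\<close>.\<close>

definition simplex_code_group :: "nat \<Rightarrow> (nat \<Rightarrow> nat \<Rightarrow> bit) \<Rightarrow> (nat \<Rightarrow> real_mod_int) set" where
  "simplex_code_group r A = group_closure (half_row r A ` {..<r})"

text \<open>\<open>D\<close> is a simplex \<open>\<Delta>(r)\<close>.  Neither the column order of \<open>A(r)\<close> nor the vertex order
  of \<open>D\<close> is fixed.\<close>

definition is_code_simplex :: "nat \<Rightarrow> (real ^ 'n) set \<Rightarrow> bool" where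
  "is_code_simplex r D \<longleftrightarrow>
     CARD('n) = 2 ^ r - 2 \<and> lattice_simplex D \<and>
     (\<exists>A vs. simplex_code_matrix r A \<and> vertex_ordering D vs \<and>
        simplex_group vs = simplex_code_group r A)"

end

theory Submission
  imports Defs
begin

text \<open>The polynomial $h^*_\Delta$ counts the elements $x$ of $\Lambda_\Delta$ by their height, the sum of the
  representatives of the coordinates in $[0, 1)$.  As the heights of $x$ and $-x$ add up to the
  number of nonzero coordinates of $x$, every element has at most $2s$ of them.  Since $\Delta$ is not
  a lattice pyramid, no coordinate vanishes on all of $\Lambda_\Delta$, so a coordinate is nonzero on at
  least half of the group.  For $4s - 1$ coordinates the average number of nonzero coordinates
  then leaves so little room that $\Lambda_\Delta$ is killed by $2$, that is, a binary code.  The second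
  moment of the weights $w$, through $\sum w (2s - w) \ge 0$, shows that all coordinates are distinct
  and that all nonzero weights equal $2s$.  Hence $|\Lambda_\Delta| = 4s = 2^k$, and the $2^k - 1$ columns
  of a generating matrix are all the nonzero vectors of $\mathbb{F}_2^k$.\<close>

text \<open>The mean weight is at least 2s - 1/2, because each of the 4s - 1 coordinates is nonzero
  on half of the group, and it is below 2s, because the zero element has weight 0. The whole
  argument for exponent two is paid from this margin of less than 1/2: a coordinate in which 0, x,
  2x differ costs an extra 1/6, one in which 0, x, 2x, 3x differ costs 1/4. So 2x has at most two
  nonzero coordinates. The margin alone does not exclude one or two; here integrality of the
  coordinate sum enters, as it forbids exactly one. On the geometric side two notions are not given
  by the group. Being a pyramid is an existential statement about unimodular maps, so a vanishing
  coordinate has to be turned into such a map; this requires extending a primitive functional to a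
  lattice basis. The degree is defined by counting lattice points, so the group is tied to it
  through the generating function.\<close>

section \<open>Closure properties of the integer lattice\<close>

lemma integer_lattice_0 [simp]: "0 \<in> integer_lattice"
  by (simp add: integer_lattice_def)

lemma integer_lattice_add: "x \<in> integer_lattice \<Longrightarrow> y \<in> integer_lattice \<Longrightarrow> x + y \<in> integer_lattice"
  by (simp add: integer_lattice_def)

lemma integer_lattice_diff: "x \<in> integer_lattice \<Longrightarrow> y \<in> integer_lattice \<Longrightarrow> x - y \<in> integer_lattice"
  by (simp add: integer_lattice_def)

lemma integer_lattice_uminus: "x \<in> integer_lattice \<Longrightarrow> - x \<in> integer_lattice"
  by (simp add: integer_lattice_def)

lemma integer_lattice_scaleR: "c \<in> \<int> \<Longrightarrow> x \<in> integer_lattice \<Longrightarrow> c *\<^sub>R x \<in> integer_lattice"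
  by (simp add: integer_lattice_def)

lemma integer_lattice_sum: "(\<And>i. i \<in> I \<Longrightarrow> f i \<in> integer_lattice) \<Longrightarrow> sum f I \<in> integer_lattice"
  by (simp add: integer_lattice_def Ints_sum)

lemma integer_lattice_axis [simp]: "axis k 1 \<in> integer_lattice"
  by (simp add: integer_lattice_def axis_def)

section \<open>Lattice automorphisms\<close>

text \<open>Phrased without matrices so that composites and inverses are easy; the integer matrix is
  recovered only in \<open>unimodularly_equivalentI\<close>.\<close>

definition lattice_automorphism :: "(real ^ 'n \<Rightarrow> real ^ 'n) \<Rightarrow> bool" where
  "lattice_automorphism g \<longleftrightarrow> linear g \<and> g ` integer_lattice = integer_lattice"

lemma lattice_automorphism_linear: "lattice_automorphism g \<Longrightarrow> linear g"
  by (simp add: lattice_automorphism_def)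

lemma lattice_automorphism_mem:
  "lattice_automorphism g \<Longrightarrow> x \<in> integer_lattice \<Longrightarrow> g x \<in> integer_lattice"
  by (auto simp: lattice_automorphism_def)

lemma lattice_automorphism_compose:
  "lattice_automorphism g \<Longrightarrow> lattice_automorphism h \<Longrightarrow> lattice_automorphism (g \<circ> h)"
  unfolding lattice_automorphism_def by (metis image_comp linear_compose)

text \<open>Surjectivity on the lattice suffices, so \<open>h\<close> is just a right inverse there
  and its linearity need not be shown; bijectivity follows by dimension.\<close>

lemma lattice_automorphismI:
  assumes "linear g" "\<And>x. x \<in> integer_lattice \<Longrightarrow> g x \<in> integer_lattice"
    and "\<And>x. x \<in> integer_lattice \<Longrightarrow> h x \<in> integer_lattice" "\<And>x. x \<in> integer_lattice \<Longrightarrow> g (h x) = x"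
  shows "lattice_automorphism g"
proof -
  have "x \<in> g ` integer_lattice" if "x \<in> integer_lattice" for x
    using assms(3,4)[OF that] by (intro image_eqI[of _ g "h x"]) simp_all
  then show ?thesis
    unfolding lattice_automorphism_def using assms(1,2) by blast
qed

lemma linear_eq_sum_axis:
  fixes g :: "real ^ 'n \<Rightarrow> 'b::real_vector"
  assumes "linear g"
  shows "g x = (\<Sum>i\<in>UNIV. x $ i *\<^sub>R g (axis i 1))"
proof -
  have "x = (\<Sum>i\<in>UNIV. x $ i *\<^sub>R axis i 1)"
    by (simp add: vec_eq_iff axis_def if_distrib[of "(*) _"] cong: if_cong)
  then have "g x = g (\<Sum>i\<in>UNIV. x $ i *\<^sub>R axis i 1)"
    by simp
  also have "\<dots> = (\<Sum>i\<in>UNIV. x $ i *\<^sub>R g (axis i 1))"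
    using assms by (simp add: linear_sum linear_cmul)
  finally show ?thesis .
qed

text \<open>The image of the lattice contains the standard basis, so \<open>g\<close> is onto, and a
  linear surjection of a finite-dimensional space onto itself is invertible.\<close>

lemma lattice_automorphism_inverse:
  assumes "lattice_automorphism g"
  obtains h where "lattice_automorphism h" "g \<circ> h = id" "h \<circ> g = id"
proof -
  have lin: "linear g" and img: "g ` integer_lattice = integer_lattice"
    using assms by (simp_all add: lattice_automorphism_def)
  have "surj g"
  proof (rule surjI)
    define a where "a i = (SOME y. g y = axis i 1)" for i
    have a: "g (a i) = axis i 1" for i
    proof -
      have "axis i 1 \<in> g ` integer_lattice"
        using img integer_lattice_axis by blast
      then show ?thesis
        unfolding a_def by (metis (mono_tags, lifting) imageE someI)
    qed
    show "g (\<Sum>i\<in>UNIV. x $ i *\<^sub>R a i) = x" for x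
    proof -
      have "g (\<Sum>i\<in>UNIV. x $ i *\<^sub>R a i) = (\<Sum>i\<in>UNIV. x $ i *\<^sub>R axis i 1)"
        using lin by (simp add: linear_sum linear_cmul a)
      also have "\<dots> = x"
        using linear_eq_sum_axis[OF linear_id, of x] by simp
      finally show ?thesis .
    qed
  qed
  then obtain h where h: "linear h" "\<forall>x. h (g x) = x" "\<forall>x. g (h x) = x"
    using linear_surjective_isomorphism[OF lin] by auto
  have "h ` integer_lattice = integer_lattice"
    using img h by (metis (no_types, lifting) image_cong image_ident image_image)
  with h that[of h] show thesis
    by (auto simp: lattice_automorphism_def fun_eq_iff)
qed

lemma lattice_automorphism_matrix:
  assumes "lattice_automorphism g"
  shows "map_matrix real_of_int (map_matrix floor (matrix g)) = matrix g"
proof -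
  have "g (axis j 1) $ i \<in> \<int>" for i j
    using lattice_automorphism_mem[OF assms integer_lattice_axis] by (auto simp: integer_lattice_def)
  then show ?thesis
    by (auto simp: vec_eq_iff map_matrix_def matrix_def elim!: Ints_cases)
qed

lemma map_matrix_of_int_mult:
  "map_matrix real_of_int (A ** B) = map_matrix real_of_int A ** map_matrix real_of_int B"
  by (simp add: vec_eq_iff map_matrix_def matrix_matrix_mult_def)

lemma map_matrix_of_int_inject: "map_matrix real_of_int A = map_matrix real_of_int B \<longleftrightarrow> A = B"
  by (simp add: vec_eq_iff map_matrix_def)

lemma map_matrix_of_int_mat_1: "map_matrix real_of_int (mat 1) = mat 1"
  by (simp add: vec_eq_iff map_matrix_def mat_def)

text \<open>The matrices of \<open>g\<close> and its inverse have integer entries, so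
  \<open>floor\<close> only changes their type and they are inverse to each other over the
  integers.\<close>

lemma unimodularly_equivalentI:
  assumes g: "lattice_automorphism g" and u: "u \<in> integer_lattice"
  shows "unimodularly_equivalent P ((\<lambda>x. g x + u) ` P)"
proof -
  obtain h where h: "lattice_automorphism h" "g \<circ> h = id" "h \<circ> g = id"
    using lattice_automorphism_inverse[OF g] by blast
  let ?A = "map_matrix floor (matrix g)" and ?B = "map_matrix floor (matrix h)"
  note A = lattice_automorphism_matrix[OF g] and B = lattice_automorphism_matrix[OF h(1)]
  have "matrix g ** matrix h = mat 1" "matrix h ** matrix g = mat 1"
    using h lattice_automorphism_linear[OF g] lattice_automorphism_linear[OF h(1)]
    by (simp_all flip: matrix_compose add: matrix_id_mat_1)
  then have "?A ** ?B = mat 1" "?B ** ?A = mat 1"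
    by (simp_all add: map_matrix_of_int_mult A B map_matrix_of_int_mat_1
        flip: map_matrix_of_int_inject)
  then have "invertible ?A"
    unfolding invertible_def by blast
  moreover have "map_matrix real_of_int ?A *v x = g x" for x
    using matrix_works[of g x] lattice_automorphism_linear[OF g]
    by (simp add: A linear_matrix_vector_mul_eq)
  ultimately show ?thesis
    using u unfolding unimodularly_equivalent_def by (intro exI[of _ ?A] exI[of _ u]) simp
qed

text \<open>Since \<open>v $ a = 0\<close>, the shear leaves the \<open>a\<close>-th coordinate
  unchanged, and subtracting the same multiple of \<open>v\<close> undoes it.\<close>

lemma lattice_automorphism_shear:
  assumes v: "v \<in> integer_lattice" "v $ a = 0"
  shows "lattice_automorphism (\<lambda>x. x + x $ a *\<^sub>R v)"
proof (rule lattice_automorphismI[where h = "\<lambda>x. x - x $ a *\<^sub>R v"])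
  show "linear (\<lambda>x. x + x $ a *\<^sub>R v)"
    by (rule linearI) (simp_all add: algebra_simps)
  show "x + x $ a *\<^sub>R v \<in> integer_lattice" "x - x $ a *\<^sub>R v \<in> integer_lattice"
    if "x \<in> integer_lattice" for x
  proof -
    have "x $ a \<in> \<int>"
      using that by (simp add: integer_lattice_def)
    then show "x + x $ a *\<^sub>R v \<in> integer_lattice" "x - x $ a *\<^sub>R v \<in> integer_lattice"
      using that v by (simp_all add: integer_lattice_add integer_lattice_diff integer_lattice_scaleR)
  qed
qed (simp add: v)

text \<open>A Euclidean algorithm on the coefficients of the functional, carried out by shears, stops at a
  multiple of one coordinate.\<close>

lemma primitive_functional_eq_coordinate:
  fixes \<phi> :: "real ^ 'n \<Rightarrow> real"
  assumes lin: "linear \<phi>" and int: "\<And>x. x \<in> integer_lattice \<Longrightarrow> \<phi> x \<in> \<int>"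
    and one: "u \<in> integer_lattice" "\<phi> u = 1"
  obtains g k where "lattice_automorphism g" "\<And>x. g x $ k = \<phi> x"
proof -
  have "\<exists>g k. lattice_automorphism g \<and> (\<forall>x. g x $ k = \<phi> x)"
    using assms
  \<comment> \<open>The coefficients are integers, so \<open>floor\<close> merely turns the sum of
    their absolute values into a natural number.\<close>
  proof (induction "\<Sum>i\<in>UNIV. nat \<lfloor>\<bar>\<phi> (axis i 1)\<bar>\<rfloor>" arbitrary: \<phi> u rule: less_induct)
    case less
    define c where "c i = \<phi> (axis i 1)" for i
    have c_int: "c i \<in> \<int>" for i
      using less.prems by (simp add: c_def)
    have phi: "\<phi> x = (\<Sum>i\<in>UNIV. x $ i * c i)" for x
      using linear_eq_sum_axis[OF less.prems(1), of x] unfolding c_def by (simp only: real_scaleR_def)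
    obtain i where i: "c i \<noteq> 0"
      using phi[of u] less.prems(4) by force
    show ?case
    proof (cases "\<exists>j. j \<noteq> i \<and> c j \<noteq> 0")
      case False
      have phi_i: "\<phi> x = c i * x $ i" for x
      proof -
        have "\<phi> x = (\<Sum>j\<in>{i}. x $ j * c j)"
          unfolding phi using False by (intro sum.mono_neutral_right) auto
        then show ?thesis
          by simp
      qed
      then have "c i * u $ i = 1"
        using less.prems by simp
      moreover have "u $ i \<in> \<int>"
        using less.prems by (simp add: integer_lattice_def)
      ultimately obtain a b where ab: "c i = of_int a" "u $ i = of_int b" "of_int (a * b) = (1::real)"
        using c_int[of i] by (auto elim!: Ints_cases)
      then have "a * b = 1"
        by linarith
      \<comment> \<open>A single remaining coefficient divides 1 by primitivity, so it is a sign and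
        scaling by it is its own inverse.\<close>
      then have "c i * c i = 1"
        using ab(1) by (auto simp: zmult_eq_1_iff)
      then have "lattice_automorphism ((*\<^sub>R) (c i))"
        using c_int[of i]
        by (intro lattice_automorphismI[where h = "(*\<^sub>R) (c i)"] linear_scaleR)
          (simp_all add: integer_lattice_scaleR)
      then show ?thesis
        using phi_i by (intro exI[of _ "(*\<^sub>R) (c i)"] exI[of _ i]) simp
    next
      case True
      then obtain j where "j \<noteq> i" "c j \<noteq> 0"
        by blast
      then obtain a b where ab: "a \<noteq> b" "c a \<noteq> 0" "c b \<noteq> 0" "\<bar>c b\<bar> \<le> \<bar>c a\<bar>"
        using i by (metis linear)
      \<comment> \<open>With this sign, subtracting the smaller coefficient from the larger one
        reduces the absolute value of the latter.\<close>
      define t where "t = sgn (c a) * sgn (c b)"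
      have t_int: "t \<in> \<int>"
        by (simp add: t_def sgn_if)
      have t: "\<bar>c a - t * c b\<bar> < \<bar>c a\<bar>"
        using ab by (auto simp: t_def sgn_if abs_if split: if_splits)
      let ?v = "(- t) *\<^sub>R axis b 1 :: real ^ 'n"
      define T where "T x = x + x $ a *\<^sub>R ?v" for x :: "real ^ 'n"
      have va: "?v $ a = 0"
        using ab by (simp add: axis_def)
      have vl: "?v \<in> integer_lattice"
        using t_int by (intro integer_lattice_scaleR) simp_all
      have T: "lattice_automorphism T"
        unfolding T_def[abs_def] by (rule lattice_automorphism_shear[OF vl va])
      obtain T' where T': "lattice_automorphism T'" "T \<circ> T' = id" "T' \<circ> T = id"
        using lattice_automorphism_inverse[OF T] by blast
      have new: "(\<phi> \<circ> T) (axis l 1) = (if l = a then c a - t * c b else c l)" for l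
        using less.prems(1) by (simp add: T_def c_def axis_def linear_diff linear_cmul)
      have "(\<Sum>l\<in>UNIV. nat \<lfloor>\<bar>(\<phi> \<circ> T) (axis l 1)\<bar>\<rfloor>) < (\<Sum>l\<in>UNIV. nat \<lfloor>\<bar>\<phi> (axis l 1)\<bar>\<rfloor>)"
      proof (rule sum_strict_mono_ex1)
        have "c a - t * c b \<in> \<int>"
          using c_int t_int by simp
        then have "nat \<lfloor>\<bar>c a - t * c b\<bar>\<rfloor> < nat \<lfloor>\<bar>c a\<bar>\<rfloor>"
          using t c_int[of a] by (auto elim!: Ints_cases simp flip: of_int_abs of_int_diff)
        then show "\<exists>l\<in>UNIV. nat \<lfloor>\<bar>(\<phi> \<circ> T) (axis l 1)\<bar>\<rfloor> < nat \<lfloor>\<bar>\<phi> (axis l 1)\<bar>\<rfloor>"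
          by (intro bexI[of _ a]) (simp_all only: new c_def simp_thms if_True UNIV_I)
        show "\<forall>l\<in>UNIV. nat \<lfloor>\<bar>(\<phi> \<circ> T) (axis l 1)\<bar>\<rfloor> \<le> nat \<lfloor>\<bar>\<phi> (axis l 1)\<bar>\<rfloor>"
          using \<open>nat \<lfloor>\<bar>c a - t * c b\<bar>\<rfloor> < nat \<lfloor>\<bar>c a\<bar>\<rfloor>\<close> unfolding new
          by (auto simp: c_def simp del: nat_less_eq_zless)
      qed simp
      moreover have "linear (\<phi> \<circ> T)"
        using less.prems(1) lattice_automorphism_linear[OF T] linear_compose by blast
      moreover have "(\<phi> \<circ> T) x \<in> \<int>" if "x \<in> integer_lattice" for x
        using less.prems(2) lattice_automorphism_mem[OF T that] by simp
      moreover have "T' u \<in> integer_lattice" "(\<phi> \<circ> T) (T' u) = 1"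
        using lattice_automorphism_mem[OF T'(1)] T'(2) less.prems(3,4)
        by (simp_all add: fun_eq_iff)
      ultimately obtain g k where g: "lattice_automorphism g" "\<forall>x. g x $ k = (\<phi> \<circ> T) x"
        using less.hyps by blast
      then have "\<forall>x. (g \<circ> T') x $ k = \<phi> x"
        using T'(2) by (simp add: fun_eq_iff)
      then show ?thesis
        using lattice_automorphism_compose[OF g(1) T'(1)] by blast
    qed
  qed
  then show thesis
    using that by blast
qed

lemma affine_image_convex_hull:
  assumes "linear g"
  shows "(\<lambda>x. g x + u) ` (convex hull S) = convex hull ((\<lambda>x. g x + u) ` S)"
proof -
  have "(\<lambda>x. g x + u) ` A = (\<lambda>x. u + x) ` g ` A" for A
    by (simp add: image_image add.commute)
  then show ?thesis
    by (simp only: convex_hull_linear_image[OF assms] convex_hull_translation)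
qed

section \<open>Lattice simplices given by their vertices\<close>

lemma real_class_eq_iff: "real_class x = real_class y \<longleftrightarrow> x - y \<in> \<int>"
  by transfer simp

lemma real_class_0: "real_class 0 = 0"
  by transfer simp

lemma real_class_eq_0_iff: "real_class x = 0 \<longleftrightarrow> x \<in> \<int>"
  using real_class_eq_iff[of x 0] by (simp add: real_class_0)

lemma real_class_add: "real_class (x + y) = real_class x + real_class y"
  by transfer simp

lemma real_class_diff: "real_class (x - y) = real_class x - real_class y"
  by transfer simp

lemma real_class_surj: obtains x where "a = real_class x"
  by transfer auto

locale lattice_simplex_vertices =
  fixes vs :: "(real ^ 'n) list"
  assumes distinct_vertices: "distinct vs"
    and affine_independent: "\<not> affine_dependent (set vs)"
    and length_vertices: "length vs = CARD('n) + 1"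
    and vertices_integer: "set vs \<subseteq> integer_lattice"
begin

definition combination :: "(nat \<Rightarrow> real) \<Rightarrow> real ^ 'n" where
  "combination x = (\<Sum>i<length vs. x i *\<^sub>R vs ! i)"

lemma combination_add: "combination (\<lambda>i. x i + y i) = combination x + combination y"
  by (simp add: combination_def scaleR_add_left sum.distrib)

lemma combination_diff: "combination (\<lambda>i. x i - y i) = combination x - combination y"
  by (simp add: combination_def scaleR_diff_left sum_subtractf)

lemma combination_scale: "combination (\<lambda>i. c * x i) = c *\<^sub>R combination x"
  by (simp add: combination_def scaleR_sum_right)

lemma combination_unit: "i < length vs \<Longrightarrow> combination (\<lambda>j. if j = i then 1 else 0) = vs ! i"
  by (simp add: combination_def if_distrib[of "\<lambda>c. c *\<^sub>R _"] cong: if_cong)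

lemma vertex_mem: "i < length vs \<Longrightarrow> vs ! i \<in> integer_lattice"
  using vertices_integer by auto

lemma sum_vertices: "(\<Sum>v\<in>set vs. f v) = (\<Sum>i<length vs. f (vs ! i))"
  using sum.reindex_bij_betw[OF bij_betw_nth[OF distinct_vertices refl refl]] by metis

lemma combination_eq_0:
  assumes "(\<Sum>i<length vs. x i) = 0" "combination x = 0" "i < length vs"
  shows "x i = 0"
proof (rule ccontr)
  assume "x i \<noteq> 0"
  \<comment> \<open>Affine dependence speaks of coefficients attached to points, so the indexed
    coefficients are carried over along the inverse of indexing.\<close>
  define U where "U v = x (the_inv_into {..<length vs} ((!) vs) v)" for v
  have U: "U (vs ! i) = x i" if "i < length vs" for i
    unfolding U_def using that distinct_vertices
    by (subst the_inv_into_f_f) (auto intro: inj_on_nth)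
  have "sum U (set vs) = 0" "(\<Sum>v\<in>set vs. U v *\<^sub>R v) = 0"
    using assms by (simp_all add: sum_vertices U combination_def)
  moreover have "vs ! i \<in> set vs" "U (vs ! i) \<noteq> 0"
    using U assms(3) \<open>x i \<noteq> 0\<close> by auto
  ultimately show False
    using affine_independent affine_dependent_explicit_finite[of "set vs"] by blast
qed

lemma affine_hull_vertices: "affine hull (set vs) = UNIV"
  using affine_independent distinct_vertices length_vertices
  by (intro affine_independent_span_eq) (simp_all add: distinct_card)

text \<open>Total, since the vertices affinely span the space. The zeros beyond the list make the
  coefficient function unique, so equalities can be stated between functions.\<close>

definition barycentric :: "real ^ 'n \<Rightarrow> nat \<Rightarrow> real" where
  "barycentric p = (SOME x. (\<forall>i\<ge>length vs. x i = 0) \<and> (\<Sum>i<length vs. x i) = 1 \<and> combination x = p)"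

lemma barycentric:
  shows barycentric_outside: "i \<ge> length vs \<Longrightarrow> barycentric p i = 0"
    and sum_barycentric: "(\<Sum>i<length vs. barycentric p i) = 1"
    and combination_barycentric: "combination (barycentric p) = p"
proof -
  obtain u where u: "sum u (set vs) = 1" "(\<Sum>v\<in>set vs. u v *\<^sub>R v) = p"
    using affine_hull_vertices affine_hull_finite[of "set vs"] by blast
  define x where "x i = (if i < length vs then u (vs ! i) else 0)" for i
  have "(\<forall>i\<ge>length vs. x i = 0) \<and> (\<Sum>i<length vs. x i) = 1 \<and> combination x = p"
    using u by (simp add: x_def sum_vertices combination_def)
  then have "\<exists>x. (\<forall>i\<ge>length vs. x i = 0) \<and> (\<Sum>i<length vs. x i) = 1 \<and> combination x = p"
    by blast
  from someI_ex[OF this] have "(\<forall>i\<ge>length vs. barycentric p i = 0) \<and> (\<Sum>i<length vs. barycentric p i) = 1 \<and>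
      combination (barycentric p) = p"
    unfolding barycentric_def .
  then show "i \<ge> length vs \<Longrightarrow> barycentric p i = 0"
    and "(\<Sum>i<length vs. barycentric p i) = 1" and "combination (barycentric p) = p"
    by auto
qed

lemma combination_inject:
  assumes "\<And>i. i \<ge> length vs \<Longrightarrow> x i = y i" "(\<Sum>i<length vs. x i) = (\<Sum>i<length vs. y i)"
    and "combination x = combination y"
  shows "x = y"
proof
  fix i
  show "x i = y i"
    using combination_eq_0[of "\<lambda>i. x i - y i" i] assms
    by (cases "i < length vs") (simp_all add: combination_diff sum_subtractf)
qed

lemma barycentric_eqI:
  assumes "\<And>i. i \<ge> length vs \<Longrightarrow> x i = 0" "(\<Sum>i<length vs. x i) = 1" "combination x = p"
  shows "barycentric p = x"
  using assms by (intro combination_inject) (simp_all add: barycentric)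

lemma barycentric_vertex:
  "i < length vs \<Longrightarrow> barycentric (vs ! i) = (\<lambda>j. if j = i then 1 else 0)"
  by (rule barycentric_eqI) (auto simp: combination_unit)

text \<open>The coordinates are affine in the point; subtracting those of the origin restores
  coordinate sum 1.\<close>

lemma barycentric_add: "barycentric (p + q) = (\<lambda>i. barycentric p i + barycentric q i - barycentric 0 i)"
  by (rule barycentric_eqI)
    (simp_all add: barycentric sum.distrib sum_subtractf combination_add combination_diff)

lemma barycentric_scale:
  "barycentric (c *\<^sub>R p) = (\<lambda>i. c * barycentric p i + (1 - c) * barycentric 0 i)"
  by (rule barycentric_eqI)
    (simp_all add: barycentric sum.distrib combination_add combination_scale flip: sum_distrib_left)

lemma linear_barycentric: "linear (\<lambda>p. barycentric p i - barycentric 0 i)"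
  by (rule linearI) (simp_all add: barycentric_add barycentric_scale algebra_simps)

lemma mem_convex_hull_iff: "p \<in> convex hull (set vs) \<longleftrightarrow> (\<forall>i. barycentric p i \<ge> 0)"
proof
  assume "p \<in> convex hull (set vs)"
  then obtain u where u: "\<forall>v\<in>set vs. 0 \<le> u v" "sum u (set vs) = 1" "(\<Sum>v\<in>set vs. u v *\<^sub>R v) = p"
    using convex_hull_finite[of "set vs"] by auto
  have "barycentric p = (\<lambda>i. if i < length vs then u (vs ! i) else 0)"
    using u by (intro barycentric_eqI) (simp_all add: sum_vertices combination_def)
  then show "\<forall>i. barycentric p i \<ge> 0"
    using u by simp
next
  assume nonneg: "\<forall>i. barycentric p i \<ge> 0"
  have "(\<Sum>i<length vs. barycentric p i *\<^sub>R vs ! i) \<in> convex hull (set vs)"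
    using nonneg by (intro convex_sum) (auto simp: barycentric hull_inc)
  then show "p \<in> convex hull (set vs)"
    using combination_barycentric[of p] by (simp add: combination_def)
qed

lemma combination_integer:
  "(\<And>i. i < length vs \<Longrightarrow> x i \<in> \<int>) \<Longrightarrow> combination x \<in> integer_lattice"
  unfolding combination_def by (intro integer_lattice_sum integer_lattice_scaleR) (auto simp: vertex_mem)

text \<open>Two representatives differ by integers, which changes the combination by a lattice point
  because the vertices are lattice points.\<close>

lemma real_class_mem_simplex_group_iff:
  assumes out: "\<And>i. i \<ge> length vs \<Longrightarrow> x i = 0"
  shows "(\<lambda>i. real_class (x i)) \<in> simplex_group vs \<longleftrightarrow>
    combination x \<in> integer_lattice \<and> (\<Sum>i<length vs. x i) \<in> \<int>"
proof
  assume "combination x \<in> integer_lattice \<and> (\<Sum>i<length vs. x i) \<in> \<int>"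
  then show "(\<lambda>i. real_class (x i)) \<in> simplex_group vs"
    using out unfolding simplex_group_def combination_def by blast
next
  assume "(\<lambda>i. real_class (x i)) \<in> simplex_group vs"
  then obtain y where y: "(\<lambda>i. real_class (x i)) = (\<lambda>i. real_class (y i))"
    "combination y \<in> integer_lattice" "(\<Sum>i<length vs. y i) \<in> \<int>"
    unfolding simplex_group_def combination_def by blast
  have int: "x i - y i \<in> \<int>" for i
    using y(1) real_class_eq_iff by metis
  have "combination x - combination y \<in> integer_lattice"
    unfolding combination_diff[symmetric] by (rule combination_integer) (rule int)
  moreover have "(\<Sum>i<length vs. x i) - (\<Sum>i<length vs. y i) \<in> \<int>"
    unfolding sum_subtractf[symmetric] by (intro Ints_sum int)
  ultimately show "combination x \<in> integer_lattice \<and> (\<Sum>i<length vs. x i) \<in> \<int>"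
    using integer_lattice_add[OF _ y(2)] Ints_add[OF _ y(3)] by (metis diff_add_cancel)
qed

lemma simplex_group_representative:
  assumes "a \<in> simplex_group vs"
  obtains x where "a = (\<lambda>i. real_class (x i))" "\<And>i. i \<ge> length vs \<Longrightarrow> x i = 0"
    "combination x \<in> integer_lattice" "(\<Sum>i<length vs. x i) \<in> \<int>"
  using assms unfolding simplex_group_def combination_def by blast

lemma barycentric_mem_simplex_group:
  "p \<in> integer_lattice \<Longrightarrow> (\<lambda>i. real_class (barycentric p i)) \<in> simplex_group vs"
  by (subst real_class_mem_simplex_group_iff) (simp_all add: barycentric)

text \<open>Lattice points have integral \<open>i\<close>-th barycentric coordinate, so vertex
  \<open>i\<close> is at lattice distance one from the opposite facet. An automorphism makes this
  distance a coordinate, and a shear then moves the apex to the unit vector.\<close>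

lemma pyramid_if_trivial_coordinate:
  assumes i: "i < length vs" and trivial: "\<And>a. a \<in> simplex_group vs \<Longrightarrow> a i = 0"
  shows "is_lattice_pyramid (convex hull (set vs))"
proof -
  define \<phi> where "\<phi> p = barycentric p i - barycentric 0 i" for p
  \<comment> \<open>A vertex of the facet serves as origin; the dimension is positive, so there are
    at least two vertices.\<close>
  obtain j where j: "j < length vs" "j \<noteq> i"
    using length_vertices i
    by (metis One_nat_def Suc_eq_plus1 less_Suc_eq_0_disj zero_less_card_finite zero_less_Suc nat_neq_iff)
  have lin: "linear \<phi>"
    unfolding \<phi>_def[abs_def] by (rule linear_barycentric)
  have bary_int: "barycentric p i \<in> \<int>" if "p \<in> integer_lattice" for p
    using trivial[OF barycentric_mem_simplex_group[OF that]] by (simp add: real_class_eq_0_iff)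
  have phi_vertex: "\<phi> (vs ! l - vs ! j) = (if l = i then 1 else 0)" if "l < length vs" for l
    using that j i unfolding linear_diff[OF lin] by (simp add: \<phi>_def barycentric_vertex)
  have "\<phi> x \<in> \<int>" if "x \<in> integer_lattice" for x
    using bary_int[OF that] bary_int[OF integer_lattice_0] by (simp add: \<phi>_def)
  moreover have "vs ! i - vs ! j \<in> integer_lattice" "\<phi> (vs ! i - vs ! j) = 1"
    using phi_vertex[OF i] i j by (simp_all add: integer_lattice_diff vertex_mem)
  ultimately obtain g k where g: "lattice_automorphism g" "\<And>x. g x $ k = \<phi> x"
    using primitive_functional_eq_coordinate[OF lin] by metis
  define w where "w l = g (vs ! l - vs ! j)" for l
  have w_int: "w l \<in> integer_lattice" if "l < length vs" for l
    unfolding w_def using that j by (intro lattice_automorphism_mem[OF g(1)] integer_lattice_diff vertex_mem)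
  have w_k: "w l $ k = (if l = i then 1 else 0)" if "l < length vs" for l
    using g(2) phi_vertex[OF that] by (simp add: w_def)
  \<comment> \<open>Both terms have \<open>k\<close>-th coordinate 1, so the shear along
    \<open>?v\<close> exists; it fixes the facet pointwise and sends \<open>w i\<close> to
    \<open>axis k 1\<close>.\<close>
  let ?v = "axis k 1 - w i"
  define T where "T x = x + x $ k *\<^sub>R ?v" for x
  have T: "lattice_automorphism T"
    unfolding T_def[abs_def] using w_int[OF i] w_k[OF i]
    by (intro lattice_automorphism_shear integer_lattice_diff) simp_all
  let ?u = "- (T \<circ> g) (vs ! j)"
  have Tg: "lattice_automorphism (T \<circ> g)"
    using T g(1) by (rule lattice_automorphism_compose)
  have u: "?u \<in> integer_lattice"
    using lattice_automorphism_mem[OF Tg vertex_mem[OF j(1)]] by (rule integer_lattice_uminus)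
  let ?f = "\<lambda>x. (T \<circ> g) x + ?u"
  have f_vertex: "?f (vs ! l) = (if l = i then axis k 1 else w l)" if "l < length vs" for l
  proof -
    have "?f (vs ! l) = (T \<circ> g) (vs ! l - vs ! j)"
      using linear_diff[OF lattice_automorphism_linear[OF Tg], of "vs ! l" "vs ! j"] by simp
    also have "\<dots> = T (w l)"
      by (simp add: w_def)
    finally show ?thesis
      using w_k[OF that] by (simp add: T_def)
  qed
  let ?Q = "convex hull (w ` ({..<length vs} - {i}))"
  have "?f ` (convex hull (set vs)) = convex hull (?f ` (set vs))"
    using lattice_automorphism_linear[OF Tg] by (rule affine_image_convex_hull)
  also have "?f ` set vs = w ` ({..<length vs} - {i}) \<union> {axis k 1}"
  proof -
    have "set vs = (!) vs ` {..<length vs}"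
      by (auto simp: set_conv_nth)
    then have "?f ` set vs = (\<lambda>l. ?f (vs ! l)) ` {..<length vs}"
      by (simp only: image_image)
    also have "\<dots> = (\<lambda>l. if l = i then axis k 1 else w l) ` {..<length vs}"
      by (rule image_cong) (simp_all only: f_vertex lessThan_iff)
    also have "\<dots> = w ` ({..<length vs} - {i}) \<union> {axis k 1}"
      using i by auto
    finally show ?thesis .
  qed
  also have "convex hull (w ` ({..<length vs} - {i}) \<union> {axis k 1}) = lattice_pyramid_over k ?Q"
    unfolding lattice_pyramid_over_def by (rule hull_Un_left)
  finally have eq: "?f ` (convex hull (set vs)) = lattice_pyramid_over k ?Q" .
  have "lattice_polytope ?Q"
    unfolding lattice_polytope_def
  proof (intro conjI allI impI)
    show "polytope ?Q"
      by (rule polytope_convex_hull) simp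
    fix v assume "v extreme_point_of ?Q"
    then show "v \<in> integer_lattice"
      using extreme_point_of_convex_hull w_int by blast
  qed
  moreover have "?Q \<subseteq> {x. x $ k = 0}"
  proof (rule hull_minimal)
    show "convex {x :: real ^ 'n. x $ k = 0}"
      unfolding convex_alt by simp
  qed (use w_k in auto)
  moreover have "unimodularly_equivalent (convex hull (set vs)) (lattice_pyramid_over k ?Q)"
    using unimodularly_equivalentI[OF Tg u, of "convex hull (set vs)"] unfolding eq .
  ultimately show ?thesis
    unfolding is_lattice_pyramid_def by blast
qed

end

text \<open>The affine map matching the ordered vertices preserves barycentric coordinates, and the
  group decides from their classes which points are lattice points. So this map and its inverse both
  preserve the lattice.\<close>

lemma unimodularly_equivalent_if_simplex_group_eq:
  fixes vs ws :: "(real ^ 'n) list"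
  assumes vs: "lattice_simplex_vertices vs" and ws: "lattice_simplex_vertices ws"
    and eq: "simplex_group vs = simplex_group ws"
  shows "unimodularly_equivalent (convex hull (set vs)) (convex hull (set ws))"
proof -
  interpret V: lattice_simplex_vertices vs by fact
  interpret W: lattice_simplex_vertices ws by fact
  have len: "length ws = length vs"
    using V.length_vertices W.length_vertices by simp
  define f where "f p = W.combination (V.barycentric p)" for p
  define f' where "f' p = V.combination (W.barycentric p)" for p
  have bary: "V.barycentric (f' q) = W.barycentric q" for q
    unfolding f'_def using len W.sum_barycentric[of q]
    by (intro V.barycentric_eqI) (simp_all add: W.barycentric_outside)
  have ff': "f (f' q) = q" for q
    unfolding f_def bary by (rule W.combination_barycentric)
  have f_int: "f p \<in> integer_lattice" if "p \<in> integer_lattice" for p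
  proof -
    have "(\<lambda>i. real_class (V.barycentric p i)) \<in> simplex_group ws"
      using V.barycentric_mem_simplex_group[OF that] eq by simp
    then show ?thesis
      unfolding f_def using W.real_class_mem_simplex_group_iff[of "V.barycentric p"]
      by (simp add: V.barycentric len)
  qed
  have f'_int: "f' p \<in> integer_lattice" if "p \<in> integer_lattice" for p
  proof -
    have "(\<lambda>i. real_class (W.barycentric p i)) \<in> simplex_group vs"
      using W.barycentric_mem_simplex_group[OF that] eq by simp
    then show ?thesis
      unfolding f'_def using V.real_class_mem_simplex_group_iff[of "W.barycentric p"]
      by (simp add: W.barycentric len)
  qed
  \<comment> \<open>The linear part of \<open>f\<close>; the translation \<open>f 0\<close> is a
    lattice point because 0 is one.\<close>
  define g where "g p = f p - f 0" for p
  have f0: "f 0 \<in> integer_lattice"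
    by (simp add: f_int)
  have "lattice_automorphism g"
  proof (rule lattice_automorphismI[where h = "\<lambda>q. f' (q + f 0)"])
    show "linear g"
      unfolding g_def f_def
      by (rule linearI) (simp_all add: V.barycentric_add V.barycentric_scale W.combination_add
          W.combination_diff W.combination_scale algebra_simps)
  qed (use f0 f_int f'_int in \<open>auto simp: g_def ff' integer_lattice_diff integer_lattice_add\<close>)
  moreover have "(\<lambda>x. g x + f 0) ` (convex hull (set vs)) = convex hull (set ws)"
  proof -
    have "(\<lambda>x. g x + f 0) ` (convex hull (set vs)) = convex hull ((\<lambda>x. g x + f 0) ` set vs)"
      using lattice_automorphism_linear[OF \<open>lattice_automorphism g\<close>]
      by (rule affine_image_convex_hull)
    also have "(\<lambda>x. g x + f 0) ` set vs = set ws"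
    proof -
      have "set vs = (!) vs ` {..<length vs}" "set ws = (!) ws ` {..<length vs}"
        using len by (auto simp: set_conv_nth)
      moreover have "f (vs ! l) = ws ! l" if "l < length vs" for l
        using that len by (simp add: f_def V.barycentric_vertex W.combination_unit)
      ultimately show ?thesis
        by (simp add: g_def image_image)
    qed
    finally show ?thesis .
  qed
  ultimately show ?thesis
    using unimodularly_equivalentI[of g "f 0" "convex hull (set vs)"] f0 by simp
qed

section \<open>Fractional parts, heights and the \<open>h_star\<close> polynomial\<close>

lift_definition fractional_part :: "real_mod_int \<Rightarrow> real" is frac
proof -
  fix x y :: real assume "x - y \<in> \<int>"
  then obtain n where "x - y = of_int n"
    by (rule Ints_cases)
  then have "x = y + of_int n"
    by simp
  then show "frac x = frac y"
    by (simp add: frac_def)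
qed

lemma fractional_part_bounds: "0 \<le> fractional_part a" "fractional_part a < 1"
  by (transfer; simp add: frac_lt_1)+

lemma real_class_fractional_part [simp]: "real_class (fractional_part a) = a"
  by transfer (simp add: frac_def)

lemma fractional_part_real_class: "fractional_part (real_class x) = frac x"
  by transfer simp

lemma fractional_part_0 [simp]: "fractional_part 0 = 0"
  by transfer simp

lemma fractional_part_uminus: "fractional_part (- a) = (if a = 0 then 0 else 1 - fractional_part a)"
  by transfer (simp add: frac_neg)

lemma finite_bounded_integer_lattice:
  fixes B :: "(real ^ 'n) set"
  assumes "bounded B"
  shows "finite (B \<inter> integer_lattice)"
proof -
  obtain R where R: "\<And>x. x \<in> B \<Longrightarrow> norm x \<le> R"
    using assms bounded_iff by blast
  let ?F = "UNIV \<rightarrow>\<^sub>E {- \<lceil>R\<rceil>..\<lceil>R\<rceil>} :: ('n \<Rightarrow> int) set"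
  have "B \<inter> integer_lattice \<subseteq> (\<lambda>f. \<chi> i. of_int (f i)) ` ?F"
  proof
    fix x assume x: "x \<in> B \<inter> integer_lattice"
    then have fl: "of_int \<lfloor>x $ i\<rfloor> = x $ i" for i
      by (auto simp: integer_lattice_def elim!: Ints_cases)
    have "\<lfloor>x $ i\<rfloor> \<in> {- \<lceil>R\<rceil>..\<lceil>R\<rceil>}" for i
    proof -
      have "\<bar>x $ i\<bar> \<le> R"
        using R x component_le_norm_cart[of x i] by force
      then have "\<bar>of_int \<lfloor>x $ i\<rfloor>\<bar> \<le> (of_int \<lceil>R\<rceil> :: real)"
        unfolding fl by linarith
      then show ?thesis
        by simp linarith
    qed
    then have mem: "(\<lambda>i. \<lfloor>x $ i\<rfloor>) \<in> ?F"
      by auto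
    have "x = (\<chi> i. of_int \<lfloor>x $ i\<rfloor>)"
      by (simp add: vec_eq_iff fl)
    then show "x \<in> (\<lambda>f. \<chi> i. of_int (f i)) ` ?F"
      using mem by (rule image_eqI)
  qed
  then show ?thesis
    by (rule finite_subset) (intro finite_imageI finite_PiE; simp)
qed

text \<open>Left as a count of lists instead of a binomial coefficient, since such lists are the
  integral parts in \<open>card_dilated_simplex\<close>.\<close>

lemma geometric_fps_power_nth:
  assumes "N > 0"
  shows "fps_nth (Abs_fps (\<lambda>_. 1 :: int) ^ N) n = int (card (natpermute n N))"
  using assms by (simp add: fps_power_nth)

context lattice_simplex_vertices
begin

lemma simplex_group_outside: "a \<in> simplex_group vs \<Longrightarrow> i \<ge> length vs \<Longrightarrow> a i = 0"
  by (erule simplex_group_representative) (simp add: real_class_0)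

lemma zero_mem_simplex_group: "0 \<in> simplex_group vs"
  using real_class_mem_simplex_group_iff[of "\<lambda>_. 0"]
  by (simp add: real_class_0 zero_fun_def combination_def)

lemma diff_mem_simplex_group:
  assumes "a \<in> simplex_group vs" "b \<in> simplex_group vs"
  shows "a - b \<in> simplex_group vs"
proof -
  obtain x where x: "a = (\<lambda>i. real_class (x i))" "\<And>i. i \<ge> length vs \<Longrightarrow> x i = 0"
    "combination x \<in> integer_lattice" "(\<Sum>i<length vs. x i) \<in> \<int>"
    using assms(1) by (rule simplex_group_representative) blast
  obtain y where y: "b = (\<lambda>i. real_class (y i))" "\<And>i. i \<ge> length vs \<Longrightarrow> y i = 0"
    "combination y \<in> integer_lattice" "(\<Sum>i<length vs. y i) \<in> \<int>"
    using assms(2) by (rule simplex_group_representative) blast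
  have "a - b = (\<lambda>i. real_class (x i - y i))"
    by (simp add: x(1) y(1) real_class_diff fun_eq_iff)
  then show ?thesis
    using x y by (simp add: real_class_mem_simplex_group_iff combination_diff sum_subtractf
        integer_lattice_diff)
qed

lemma fractional_parts_of_simplex_group:
  assumes "a \<in> simplex_group vs"
  shows "combination (\<lambda>i. fractional_part (a i)) \<in> integer_lattice"
    and "(\<Sum>i<length vs. fractional_part (a i)) \<in> \<int>"
  using assms real_class_mem_simplex_group_iff[of "\<lambda>i. fractional_part (a i)"]
  by (simp_all add: simplex_group_outside)

text \<open>On the group the sum is already a nonnegative integer, so \<open>nat\<close> and
  \<open>floor\<close> only change the type.\<close>

definition height :: "(nat \<Rightarrow> real_mod_int) \<Rightarrow> nat" where
  "height a = nat \<lfloor>\<Sum>i<length vs. fractional_part (a i)\<rfloor>"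

lemma height_eq:
  assumes "a \<in> simplex_group vs"
  shows "real (height a) = (\<Sum>i<length vs. fractional_part (a i))"
proof -
  have "(\<Sum>i<length vs. fractional_part (a i)) \<ge> 0"
    by (intro sum_nonneg fractional_part_bounds)
  then show ?thesis
    using fractional_parts_of_simplex_group(2)[OF assms]
    by (auto simp: height_def elim!: Ints_cases)
qed

text \<open>The height and the combination of the fractional parts determine an element, as the
  coefficient sum and the point determine the coefficients. Both take finitely many values because
  fractional parts are bounded.\<close>

lemma finite_simplex_group: "finite (simplex_group vs)"
proof -
  let ?c = "\<lambda>a :: nat \<Rightarrow> real_mod_int. combination (\<lambda>i. fractional_part (a i))"
  let ?B = "cball 0 (\<Sum>i<length vs. norm (vs ! i)) :: (real ^ 'n) set"
  have "inj_on (\<lambda>a. (height a, ?c a)) (simplex_group vs)"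
  proof (rule inj_onI)
    fix a b assume ab: "a \<in> simplex_group vs" "b \<in> simplex_group vs"
      "(height a, ?c a) = (height b, ?c b)"
    have "(\<lambda>i. fractional_part (a i)) = (\<lambda>i. fractional_part (b i))"
      using ab height_eq[of a] height_eq[of b]
      by (intro combination_inject) (simp_all add: simplex_group_outside)
    then show "a = b"
      by (metis ext real_class_fractional_part)
  qed
  moreover have "(\<lambda>a. (height a, ?c a)) ` simplex_group vs \<subseteq> {..length vs} \<times> (?B \<inter> integer_lattice)"
  proof (rule image_subsetI)
    fix a assume a: "a \<in> simplex_group vs"
    have "real (height a) \<le> (\<Sum>i<length vs. 1)"
      unfolding height_eq[OF a] by (intro sum_mono less_imp_le fractional_part_bounds)
    then have "height a \<le> length vs"
      by simp
    moreover have "norm (?c a) \<le> (\<Sum>i<length vs. norm (vs ! i))"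
      unfolding combination_def
      by (rule order_trans[OF norm_sum]) (intro sum_mono, simp add: fractional_part_bounds
          less_imp_le mult_left_le_one_le)
    ultimately show "(height a, ?c a) \<in> {..length vs} \<times> (?B \<inter> integer_lattice)"
      using fractional_parts_of_simplex_group(1)[OF a] by simp
  qed
  moreover have "finite ({..length vs} \<times> (?B \<inter> integer_lattice))"
    by (intro finite_cartesian_product finite_bounded_integer_lattice) simp_all
  ultimately show ?thesis
    by (rule inj_on_finite)
qed

lemma height_add_height_uminus:
  assumes "a \<in> simplex_group vs"
  shows "height a + height (- a) = card {i \<in> {..<length vs}. a i \<noteq> 0}"
proof -
  have neg: "- a \<in> simplex_group vs"
    using diff_mem_simplex_group[OF zero_mem_simplex_group assms] by simp
  have "real (height a + height (- a)) =
      (\<Sum>i<length vs. fractional_part (a i) + fractional_part (- a i))"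
    by (simp add: height_eq[OF assms] height_eq[OF neg] sum.distrib)
  also have "\<dots> = (\<Sum>i<length vs. if a i \<noteq> 0 then 1 else 0)"
    by (intro sum.cong refl) (simp add: fractional_part_uminus)
  also have "\<dots> = real (card {i \<in> {..<length vs}. a i \<noteq> 0})"
    by (simp add: sum.If_cases Int_def)
  finally show ?thesis
    by simp
qed

text \<open>A lone nonzero coordinate would carry the whole coordinate sum, which is an integer, and
  so be the zero class.\<close>

lemma card_support_simplex_group:
  assumes a: "a \<in> simplex_group vs"
  shows "card {i \<in> {..<length vs}. a i \<noteq> 0} \<noteq> 1"
proof
  assume "card {i \<in> {..<length vs}. a i \<noteq> 0} = 1"
  then obtain i where i: "{i \<in> {..<length vs}. a i \<noteq> 0} = {i}"
    by (auto simp: card_1_singleton_iff)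
  have "(\<Sum>j<length vs. fractional_part (a j)) = (\<Sum>j\<in>{i}. fractional_part (a j))"
  proof (rule sum.mono_neutral_right)
    show "{i} \<subseteq> {..<length vs}" "\<forall>j\<in>{..<length vs} - {i}. fractional_part (a j) = 0"
      using i by (blast, metis (mono_tags, lifting) DiffD1 DiffD2 fractional_part_0 mem_Collect_eq)
  qed simp
  then have "fractional_part (a i) \<in> \<int>"
    using fractional_parts_of_simplex_group(2)[OF a] by simp
  then have "a i = 0"
    using real_class_eq_0_iff[of "fractional_part (a i)"] by simp
  then show False
    using i by blast
qed

lemma mem_dilated_simplex_iff:
  "p \<in> (\<lambda>x. real n *\<^sub>R x) ` (convex hull (set vs)) \<longleftrightarrow>
    (\<exists>x. (\<forall>i\<ge>length vs. x i = 0) \<and> (\<forall>i. x i \<ge> 0) \<and> (\<Sum>i<length vs. x i) = real n \<and>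
      combination x = p)"
proof
  assume "p \<in> (\<lambda>x. real n *\<^sub>R x) ` (convex hull (set vs))"
  then obtain q where q: "q \<in> convex hull (set vs)" "p = real n *\<^sub>R q"
    by blast
  show "\<exists>x. (\<forall>i\<ge>length vs. x i = 0) \<and> (\<forall>i. x i \<ge> 0) \<and> (\<Sum>i<length vs. x i) = real n \<and>
      combination x = p"
    using q(1) unfolding mem_convex_hull_iff q(2)
    by (intro exI[of _ "\<lambda>i. real n * barycentric q i"])
      (simp add: barycentric combination_scale flip: sum_distrib_left)
next
  assume "\<exists>x. (\<forall>i\<ge>length vs. x i = 0) \<and> (\<forall>i. x i \<ge> 0) \<and> (\<Sum>i<length vs. x i) = real n \<and>
      combination x = p"
  then obtain x where x: "\<forall>i\<ge>length vs. x i = 0" "\<forall>i. x i \<ge> 0" "(\<Sum>i<length vs. x i) = real n"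
    "combination x = p"
    by blast
  show "p \<in> (\<lambda>x. real n *\<^sub>R x) ` (convex hull (set vs))"
  proof (cases "n = 0")
    \<comment> \<open>Division by \<open>n\<close> is impossible here; the dilate is the origin
      alone, and \<open>vs ! 0\<close> shows that the simplex is nonempty.\<close>
    case True
    then have "\<forall>i<length vs. x i = 0"
      using x(2,3) by (simp add: sum_nonneg_eq_0_iff)
    then have "p = 0"
      using x(4) by (simp add: combination_def)
    moreover have "vs ! 0 \<in> convex hull (set vs)"
      using length_vertices by (intro hull_inc nth_mem) simp
    ultimately show ?thesis
      using True by force
  next
    case False
    have "barycentric ((1 / real n) *\<^sub>R p) = (\<lambda>i. (1 / real n) * x i)"
      using x False by (intro barycentric_eqI; (simp only: combination_scale)?; (simp flip: sum_divide_distrib)?)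
    then have "(1 / real n) *\<^sub>R p \<in> convex hull (set vs)"
      using x(2) by (simp add: mem_convex_hull_iff)
    then show ?thesis
      using False by (intro image_eqI[of _ _ "(1 / real n) *\<^sub>R p"]) simp_all
  qed
qed

text \<open>Splitting the coefficients of a lattice point of the dilated simplex into fractional and
  integral parts.\<close>

lemma card_dilated_simplex:
  "card ((\<lambda>x. real n *\<^sub>R x) ` (convex hull (set vs)) \<inter> integer_lattice) =
    (\<Sum>a\<in>simplex_group vs. if height a \<le> n then card (natpermute (n - height a) (length vs)) else 0)"
proof -
  \<comment> \<open>The case distinction keeps truncated subtraction from counting a spurious list
    when the height exceeds \<open>n\<close>; in \<open>c\<close> the guard avoids list entries
    beyond the end.\<close>
  define K where "K a = (if height a \<le> n then natpermute (n - height a) (length vs) else {})" for a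
  define c where "c a k i = fractional_part (a i) + (if i < length vs then real (k ! i) else 0)"
    for a :: "nat \<Rightarrow> real_mod_int" and k :: "nat list" and i :: nat
  let ?f = "\<lambda>(a, k). combination (c a k)"
  let ?P = "(\<lambda>x. real n *\<^sub>R x) ` (convex hull (set vs)) \<inter> integer_lattice"
  have K: "height a \<le> n" "length k = length vs" "sum_list k = n - height a" if "k \<in> K a" for a k
    using that by (auto simp: K_def natpermute_def split: if_splits)
  have c_out: "c a k i = 0" if "a \<in> simplex_group vs" "i \<ge> length vs" for a k i
    using that by (simp add: c_def simplex_group_outside)
  have c_sum: "(\<Sum>i<length vs. c a k i) = real n" if "a \<in> simplex_group vs" "k \<in> K a" for a k
  proof -
    have "(\<Sum>i<length vs. real (k ! i)) = real (n - height a)"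
      using K(2,3)[OF that(2)] by (simp add: sum_list_sum_nth atLeast0LessThan flip: of_nat_sum)
    then show ?thesis
      using K(1)[OF that(2)] by (simp add: c_def sum.distrib of_nat_diff flip: height_eq[OF that(1)])
  qed
  have "inj_on ?f (Sigma (simplex_group vs) K)"
  proof (rule inj_onI, clarify)
    fix a k b l
    assume *: "a \<in> simplex_group vs" "k \<in> K a" "b \<in> simplex_group vs" "l \<in> K b"
      "combination (c a k) = combination (c b l)"
    have c: "c a k = c b l"
      using * by (intro combination_inject) (simp_all add: c_out c_sum)
    \<comment> \<open>The group element is recovered from the coefficients because the added parts
      are integers.\<close>
    have cls: "real_class (c a k i) = a i" for a k i
    proof -
      have "real_class (c a k i) = real_class (fractional_part (a i))"
        unfolding real_class_eq_iff by (simp add: c_def)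
      then show ?thesis
        by simp
    qed
    have "a = b"
      using cls c by (metis ext)
    moreover have "k = l"
    proof (rule nth_equalityI)
      show "length k = length l"
        using K(2) * by simp
      show "k ! i = l ! i" if "i < length k" for i
        using fun_cong[OF c, of i] that K(2)[OF *(2)] \<open>a = b\<close> by (simp add: c_def)
    qed
    ultimately show "a = b \<and> k = l"
      by simp
  qed
  moreover have "?f ` Sigma (simplex_group vs) K = ?P"
  proof (intro antisym subsetI)
    fix p assume "p \<in> ?f ` Sigma (simplex_group vs) K"
    then obtain a k where ak: "a \<in> simplex_group vs" "k \<in> K a" "p = combination (c a k)"
      by auto
    have "\<forall>i. c a k i \<ge> 0"
      by (simp add: c_def fractional_part_bounds)
    then have "p \<in> (\<lambda>x. real n *\<^sub>R x) ` (convex hull (set vs))"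
      unfolding mem_dilated_simplex_iff using ak c_out c_sum by (intro exI[of _ "c a k"]) simp
    moreover have "p \<in> integer_lattice"
      unfolding ak(3) c_def combination_add
      using ak(1) by (intro integer_lattice_add fractional_parts_of_simplex_group(1) combination_integer) simp_all
    ultimately show "p \<in> ?P"
      by blast
  next
    fix p assume "p \<in> ?P"
    then obtain x where x: "\<forall>i\<ge>length vs. x i = 0" "\<forall>i. x i \<ge> 0" "(\<Sum>i<length vs. x i) = real n"
      "combination x = p" and p: "p \<in> integer_lattice"
      unfolding mem_dilated_simplex_iff Int_iff by blast
    define a where "a i = real_class (x i)" for i
    define k where "k = map (\<lambda>i. nat \<lfloor>x i\<rfloor>) [0..<length vs]"
    have a: "a \<in> simplex_group vs"
      using real_class_mem_simplex_group_iff[of x] x p by (simp add: a_def[abs_def])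
    have kx: "real (k ! i) = of_int \<lfloor>x i\<rfloor>" if "i < length vs" for i
      using that x(2) by (simp add: k_def)
    have c: "c a k = x"
      using x(1) by (auto simp: fun_eq_iff c_def a_def fractional_part_real_class frac_def kx)
    have "real (sum_list k) = (\<Sum>i<length vs. of_int \<lfloor>x i\<rfloor>)"
    proof -
      have "real (sum_list k) = (\<Sum>i<length vs. real (k ! i))"
        by (simp add: sum_list_sum_nth atLeast0LessThan k_def)
      then show ?thesis
        using kx by simp
    qed
    moreover have "real (height a) = (\<Sum>i<length vs. frac (x i))"
      unfolding height_eq[OF a] by (simp add: a_def fractional_part_real_class)
    ultimately have "real (height a) + real (sum_list k) = real n"
      using x(3) by (simp add: frac_def sum_subtractf)
    then have "height a + sum_list k = n"
      by linarith
    then have "k \<in> K a"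
      by (auto simp: K_def natpermute_def k_def)
    then show "p \<in> ?f ` Sigma (simplex_group vs) K"
      using a c x(4) by (intro image_eqI[of _ _ "(a, k)"]) simp_all
  qed
  ultimately have "card ?P = card (Sigma (simplex_group vs) K)"
    by (metis card_image)
  also have "\<dots> = (\<Sum>a\<in>simplex_group vs. card (K a))"
    using finite_simplex_group by (intro card_SigmaI) (auto simp: K_def natpermute_finite)
  also have "\<dots> = (\<Sum>a\<in>simplex_group vs.
      if height a \<le> n then card (natpermute (n - height a) (length vs)) else 0)"
    by (intro sum.cong refl) (simp add: K_def)
  finally show ?thesis .
qed

text \<open>Each group element contributes its monomial times the series of (1 - t)^-(d+1), whose
  exponent is the number of vertices.\<close>

lemma h_star_eq: "h_star (convex hull (set vs)) = (\<Sum>a\<in>simplex_group vs. monom 1 (height a))"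
proof (rule h_star_eqI)
  let ?S = "Abs_fps (\<lambda>_. 1 :: int)"
  have "aff_dim (convex hull (set vs)) = int CARD('n)"
    using affine_hull_vertices aff_dim_affine_hull[of "set vs"] by (simp add: aff_dim_convex_hull)
  then have dim: "nat (aff_dim (convex hull (set vs)) + 1) = length vs"
    using length_vertices by simp
  have len: "length vs > 0"
    using length_vertices by simp
  have series: "ehrhart_series (convex hull (set vs)) =
      (\<Sum>a\<in>simplex_group vs. fps_X ^ height a * ?S ^ length vs)"
  proof (rule fps_ext)
    fix n
    show "fps_nth (ehrhart_series (convex hull (set vs))) n =
        fps_nth (\<Sum>a\<in>simplex_group vs. fps_X ^ height a * ?S ^ length vs) n"
      unfolding ehrhart_series_def fps_nth_Abs_fps card_dilated_simplex fps_sum_nth of_nat_sum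
      by (intro sum.cong refl)
        (simp add: fps_X_power_mult_nth geometric_fps_power_nth[OF len] del: power_Suc)
  qed
  have geo: "?S * (1 - fps_X) = 1"
    by (rule fps_ext) (simp add: right_diff_distrib)
  have "fps_of_poly (\<Sum>a\<in>simplex_group vs. monom (1::int) (height a)) =
      (\<Sum>a\<in>simplex_group vs. fps_X ^ height a)"
    by (simp add: fps_of_poly_sum fps_of_poly_monom')
  also have "\<dots> = (\<Sum>a\<in>simplex_group vs. fps_X ^ height a) * (?S * (1 - fps_X)) ^ length vs"
    by (simp only: geo power_one mult_1_right)
  also have "\<dots> = ehrhart_series (convex hull (set vs)) * (1 - fps_X) ^ length vs"
    by (simp only: series power_mult_distrib sum_distrib_right mult.assoc)
  finally show "fps_of_poly (\<Sum>a\<in>simplex_group vs. monom 1 (height a)) =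
      ehrhart_series (convex hull (set vs)) * (1 - fps_X) ^ nat (aff_dim (convex hull (set vs)) + 1)"
    unfolding dim .
qed

text \<open>No cancellation can occur: the coefficient at a height counts the elements of that
  height.\<close>

lemma height_le_degree:
  assumes "a \<in> simplex_group vs"
  shows "height a \<le> polytope_degree (convex hull (set vs))"
proof -
  have "coeff (h_star (convex hull (set vs))) (height a) =
      int (card {b \<in> simplex_group vs. height b = height a})"
    unfolding h_star_eq coeff_sum using finite_simplex_group
    by (simp add: sum.If_cases Int_def)
  moreover have "card {b \<in> simplex_group vs. height b = height a} > 0"
    using assms finite_simplex_group by (auto simp: card_gt_0_iff)
  ultimately show ?thesis
    unfolding polytope_degree_def by (intro le_degree) simp
qed

end

section \<open>Groups with small supports\<close>

text \<open>Needed for the relabelling of coordinates by a permutation, which carries generators to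
  generators.\<close>

lemma image_group_closure:
  fixes f :: "'a::ab_group_add \<Rightarrow> 'b::ab_group_add"
  assumes "\<And>x y. f (x - y) = f x - f y"
  shows "f ` group_closure S = group_closure (f ` S)"
proof -
  have f0: "f 0 = 0"
    using assms[of 0 0] by simp
  show ?thesis
  proof (rule antisym)
    have "f x \<in> group_closure (f ` S)" if "x \<in> group_closure S" for x
      using that
    proof induction
      case (base s)
      then show ?case
        using f0 by (cases "s = 0") (auto intro: group_closure.base)
    next
      case (diff s t)
      then show ?case
        by (simp add: assms group_closure.diff)
    qed
    then show "f ` group_closure S \<subseteq> group_closure (f ` S)"
      by blast
  next
    have "y \<in> f ` group_closure S" if "y \<in> group_closure (f ` S)" for y
      using that
    proof induction
      case (base s)
      then consider "s = 0" | x where "x \<in> S" "s = f x"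
        by blast
      then show ?case
      proof cases
        case 1
        then show ?thesis
          using f0 by (intro image_eqI[of _ f 0]) simp_all
      next
        case 2
        then show ?thesis
          by (auto intro: group_closure.base)
      qed
    next
      case (diff s t)
      then obtain x y where "x \<in> group_closure S" "y \<in> group_closure S" "s = f x" "t = f y"
        by blast
      then show ?case
        by (intro image_eqI[of _ f "x - y"]) (auto simp: assms intro: group_closure.diff)
    qed
    then show "group_closure (f ` S) \<subseteq> f ` group_closure S"
      by blast
  qed
qed

lemma group_closure_subset:
  fixes S :: "'a::ab_group_add set"
  assumes "S \<subseteq> G" "0 \<in> G" "\<And>x y. x \<in> G \<Longrightarrow> y \<in> G \<Longrightarrow> x - y \<in> G"
  shows "group_closure S \<subseteq> G"
proof
  fix x assume "x \<in> group_closure S"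
  then show "x \<in> G"
    by induction (use assms in auto)
qed

text \<open>Two cosets suffice, because \<open>- g = g\<close> makes their union closed under
  differences.\<close>

lemma group_closure_insert_involution:
  fixes g :: "'a::ab_group_add"
  assumes g: "g + g = 0"
  shows "group_closure (insert g S) = group_closure S \<union> (+) g ` group_closure S"
proof (rule antisym)
  have g': "- g = g"
    using g by (rule minus_unique)
  have "x \<in> group_closure S \<union> (+) g ` group_closure S" if "x \<in> group_closure (insert g S)" for x
    using that
  proof induction
    case (base s)
    then show ?case
      by (auto intro: group_closure.base image_eqI[of _ _ 0])
  next
    case (diff s t)
    then obtain a b where ab: "a \<in> group_closure S" "b \<in> group_closure S"
      "s = a \<or> s = g + a" "t = b \<or> t = g + b"
      by blast
    have "a - b \<in> group_closure S"
      using ab by (simp add: group_closure.diff)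
    moreover have "s - t = a - b \<or> s - t = g + (a - b)"
    proof -
      have "a - (g + b) = - g + (a - b)"
        by simp
      then have "a - (g + b) = g + (a - b)"
        by (simp only: g')
      then show ?thesis
        using ab by (auto simp: algebra_simps)
    qed
    ultimately show ?case
      by (metis UnCI imageI)
  qed
  then show "group_closure (insert g S) \<subseteq> group_closure S \<union> (+) g ` group_closure S"
    by blast
  have sub: "group_closure S \<subseteq> group_closure (insert g S)"
    by (rule group_closure_subset) (auto intro: group_closure.base group_closure.diff)
  then show "group_closure S \<union> (+) g ` group_closure S \<subseteq> group_closure (insert g S)"
    by (auto intro!: group_closure_add intro: group_closure.base)
qed

text \<open>Greedy choice of a basis over the field with two elements: a generator outside the
  current closure doubles its size.\<close>

lemma involutive_group_generators:
  fixes G :: "'a::ab_group_add set"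
  assumes fin: "finite G" and zero: "0 \<in> G"
    and diff: "\<And>x y. x \<in> G \<Longrightarrow> y \<in> G \<Longrightarrow> x - y \<in> G"
    and inv: "\<And>x. x \<in> G \<Longrightarrow> x + x = 0"
  obtains gs where "set gs \<subseteq> G" "group_closure (set gs) = G" "card G = 2 ^ length gs"
proof -
  have "\<exists>gs. set gs \<subseteq> G \<and> group_closure (set gs) = G \<and> card G = 2 ^ length gs"
    if "set hs \<subseteq> G" "card (group_closure (set hs)) = 2 ^ length hs" for hs
    using that
  proof (induction "card G - card (group_closure (set hs))" arbitrary: hs rule: less_induct)
    case less
    let ?H = "group_closure (set hs)"
    have HG: "?H \<subseteq> G"
      using less.prems zero diff by (intro group_closure_subset)
    show ?case
    proof (cases "?H = G")
      case True
      then show ?thesis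
        using less.prems by metis
    next
      case False
      then obtain g where g: "g \<in> G" "g \<notin> ?H"
        using HG by blast
      have gg: "g + g = 0"
        using inv g by blast
      have eq: "group_closure (set (g # hs)) = ?H \<union> (+) g ` ?H"
        using group_closure_insert_involution[OF gg] by simp
      have disj: "?H \<inter> (+) g ` ?H = {}"
      proof (rule ccontr)
        assume "?H \<inter> (+) g ` ?H \<noteq> {}"
        then obtain a b where "a \<in> ?H" "b \<in> ?H" "a = g + b"
          by blast
        then have "g = a - b"
          by simp
        then show False
          using g \<open>a \<in> ?H\<close> \<open>b \<in> ?H\<close> group_closure.diff by blast
      qed
      have finH: "finite ?H"
        using HG fin finite_subset by blast
      have card: "card (group_closure (set (g # hs))) = 2 * card ?H"
        unfolding eq using finH disj by (simp add: card_Un_disjoint card_image)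
      have sub: "group_closure (set (g # hs)) \<subseteq> G"
        using less.prems g zero diff by (intro group_closure_subset) auto
      then have "card (group_closure (set (g # hs))) \<le> card G"
        using fin by (rule card_mono[rotated])
      moreover have "card ?H > 0"
        using less.prems by simp
      ultimately have "card G - card (group_closure (set (g # hs))) < card G - card ?H"
        using card by linarith
      then show ?thesis
        using less.hyps[of "g # hs"] less.prems g card by simp
    qed
  qed
  from this[of "[]"] show ?thesis
    using that by auto
qed

section \<open>Nonzero binary columns and existence of code matrices\<close>

lemma
  shows finite_nonzero_bit_lists: "finite {c :: bit list. length c = k \<and> c \<noteq> replicate k 0}"
    and card_nonzero_bit_lists: "card {c :: bit list. length c = k \<and> c \<noteq> replicate k 0} = 2 ^ k - 1"
proof -
  have UNIV_bit: "(UNIV :: bit set) = {0, 1}"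
    by auto
  have bits: "finite (UNIV :: bit set)" "CARD(bit) = 2"
    unfolding UNIV_bit by simp_all
  have lists: "finite {c :: bit list. length c = k}" "card {c :: bit list. length c = k} = 2 ^ k"
    using finite_lists_length_eq[OF bits(1), of k] card_lists_length_eq[OF bits(1), of k]
    by (simp_all add: bits)
  have "{c :: bit list. length c = k \<and> c \<noteq> replicate k 0} = {c. length c = k} - {replicate k 0}"
    by blast
  then show "finite {c :: bit list. length c = k \<and> c \<noteq> replicate k 0}"
    and "card {c :: bit list. length c = k \<and> c \<noteq> replicate k 0} = 2 ^ k - 1"
    using lists by simp_all
qed

lemma simplex_code_matrix_exists: "\<exists>A. simplex_code_matrix k A"
proof -
  let ?C = "{c :: bit list. length c = k \<and> c \<noteq> replicate k 0}"
  obtain f where f: "bij_betw f {..<2 ^ k - 1 :: nat} ?C"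
    using ex_bij_betw_nat_finite[OF finite_nonzero_bit_lists[of k]]
    by (auto simp: card_nonzero_bit_lists atLeast0LessThan)
  have "map (\<lambda>i. f j ! i) [0..<k] = f j" if "j < 2 ^ k - 1" for j
  proof -
    have "length (f j) = k"
      using bij_betwE[OF f] that by auto
    then show ?thesis
      using map_nth[of "f j"] by simp
  qed
  then have "simplex_code_matrix k (\<lambda>i j. f j ! i)"
    unfolding simplex_code_matrix_def using f by (subst bij_betw_cong[where g = f]) auto
  then show ?thesis
    by blast
qed

text \<open>The elements of a subgroup of $(\mathbb{R}/\mathbb{Z})^m$ with integer coordinate sum never have
  exactly one nonzero coordinate; this is the only trace of integrality needed below.\<close>

locale coordinate_group =
  fixes G :: "(nat \<Rightarrow> 'a::ab_group_add) set" and m :: nat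
  assumes finite_group: "finite G"
    and zero_mem: "0 \<in> G"
    and diff_mem: "x \<in> G \<Longrightarrow> y \<in> G \<Longrightarrow> x - y \<in> G"
    and support_subset: "x \<in> G \<Longrightarrow> i \<ge> m \<Longrightarrow> x i = 0"
    and coordinate_nontrivial: "i < m \<Longrightarrow> \<exists>x\<in>G. x i \<noteq> 0"
    and card_support_neq_1: "x \<in> G \<Longrightarrow> card {i \<in> {..<m}. x i \<noteq> 0} \<noteq> 1"
begin

definition weight :: "(nat \<Rightarrow> 'a) \<Rightarrow> nat" where
  "weight x = card {i \<in> {..<m}. x i \<noteq> 0}"

definition nonzeros :: "nat \<Rightarrow> nat" where
  "nonzeros i = card {x \<in> G. x i \<noteq> 0}"

lemma uminus_mem: "x \<in> G \<Longrightarrow> - x \<in> G"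
  using diff_mem[OF zero_mem] by fastforce

lemma add_mem: "x \<in> G \<Longrightarrow> y \<in> G \<Longrightarrow> x + y \<in> G"
  using diff_mem[of x "- y"] uminus_mem by simp

lemma card_group_pos: "card G > 0"
  using finite_group zero_mem card_gt_0_iff by blast

lemma weight_eq_0_iff:
  assumes "x \<in> G" shows "weight x = 0 \<longleftrightarrow> x = 0"
proof
  assume "weight x = 0"
  then have "\<And>i. i < m \<Longrightarrow> x i = 0"
    unfolding weight_def by (auto simp: card_eq_0_iff)
  then show "x = 0"
    using support_subset[OF assms] by (metis ext not_le zero_fun_apply)
qed (simp add: weight_def)

text \<open>Double counting; a general \<open>I\<close> is allowed because \<open>involution\<close>
  leaves out two coordinates.\<close>

lemma sum_card_support:
  assumes "finite I"
  shows "(\<Sum>x\<in>G. card {i \<in> I. x i \<noteq> 0}) = (\<Sum>i\<in>I. nonzeros i)"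
proof -
  have "(\<Sum>x\<in>G. card {i \<in> I. x i \<noteq> 0}) = (\<Sum>x\<in>G. \<Sum>i\<in>I. if x i \<noteq> 0 then 1 else 0)"
    using assms by (intro sum.cong refl) (simp add: sum.If_cases Int_def)
  also have "\<dots> = (\<Sum>i\<in>I. \<Sum>x\<in>G. if x i \<noteq> 0 then 1 else 0)"
    by (rule sum.swap)
  also have "\<dots> = (\<Sum>i\<in>I. nonzeros i)"
    using finite_group by (intro sum.cong refl) (simp add: sum.If_cases Int_def nonzeros_def)
  finally show ?thesis .
qed

lemma sum_weight: "(\<Sum>x\<in>G. weight x) = (\<Sum>i<m. nonzeros i)"
  unfolding weight_def by (rule sum_card_support) simp

text \<open>The elements \<open>ts\<close> lie in different cosets of the kernel of coordinate
  \<open>i\<close>, so this kernel has at most \<open>card G\<close> divided by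
  \<open>length ts\<close> elements. Used below for two, three and four multiples of one
  element.\<close>

lemma nonzeros_ge:
  assumes ts: "set ts \<subseteq> G" and dist: "distinct (map (\<lambda>t. t i) ts)"
  shows "(length ts - 1) * card G \<le> length ts * nonzeros i"
proof -
  let ?Z = "{x \<in> G. x i = 0}"
  have inj: "inj_on (\<lambda>(t, x). t + x) (set ts \<times> ?Z)"
  proof (rule inj_onI, clarify)
    fix t x t' x' assume a: "t \<in> set ts" "t' \<in> set ts" "x i = 0" "x' i = 0" "t + x = t' + x'"
    then have "t i = t' i"
      by (metis add.right_neutral plus_fun_apply)
    then have "t = t'"
      using dist a by (auto simp: distinct_map inj_on_def)
    then show "t = t' \<and> x = x'"
      using a by simp
  qed
  have "(\<lambda>(t, x). t + x) ` (set ts \<times> ?Z) \<subseteq> G"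
    using ts add_mem by auto
  then have "card (set ts \<times> ?Z) \<le> card G"
    using card_inj_on_le[OF inj] finite_group by blast
  moreover have "card (set ts) = length ts"
    using dist by (simp add: distinct_map distinct_card)
  ultimately have le: "length ts * card ?Z \<le> card G"
    by (simp add: card_cartesian_product)
  have "card G = card ?Z + nonzeros i"
  proof -
    have "card (?Z \<union> {x \<in> G. x i \<noteq> 0}) = card ?Z + nonzeros i"
      unfolding nonzeros_def using finite_group by (intro card_Un_disjoint) auto
    moreover have "?Z \<union> {x \<in> G. x i \<noteq> 0} = G"
      by blast
    ultimately show ?thesis
      by simp
  qed
  then have "length ts * card G = length ts * card ?Z + length ts * nonzeros i"
    by (simp add: distrib_left)
  with le show ?thesis
    by (simp add: diff_mult_distrib)
qed

lemma two_nonzeros_ge: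
  assumes "i < m" shows "card G \<le> 2 * nonzeros i"
proof -
  obtain x where "x \<in> G" "x i \<noteq> 0"
    using coordinate_nontrivial[OF assms] by blast
  then show ?thesis
    using nonzeros_ge[of "[0, x]" i] zero_mem by auto
qed

lemma three_nonzeros_ge:
  assumes "x \<in> G" "x i + x i \<noteq> 0" shows "2 * card G \<le> 3 * nonzeros i"
proof -
  have "x i \<noteq> 0"
    using assms(2) by auto
  then show ?thesis
    using nonzeros_ge[of "[0, x, x + x]" i] zero_mem add_mem assms by auto
qed

lemma four_nonzeros_ge:
  assumes "x \<in> G" "x i + x i \<noteq> 0" "x i + x i + (x i + x i) = 0"
  shows "3 * card G \<le> 4 * nonzeros i"
proof -
  have "x i \<noteq> 0"
    using assms(2) by auto
  \<comment> \<open>If three times \<open>x i\<close> were zero, four times it being zero would give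
    \<open>x i = 0\<close>.\<close>
  moreover have "x i + x i + x i \<noteq> 0"
    using assms(3) \<open>x i \<noteq> 0\<close> by (metis add.assoc add.left_neutral)
  ultimately have "distinct (map (\<lambda>t. t i) [0, x, x + x, x + x + x])"
    using assms(2) by (auto simp: add.assoc)
  then show ?thesis
    using nonzeros_ge[of "[0, x, x + x, x + x + x]" i] zero_mem add_mem assms by auto
qed

end

section \<open>Exponent two in the extremal dimension\<close>

locale extremal_coordinate_group = coordinate_group +
  fixes s :: nat
  assumes dim_eq: "m + 1 = 4 * s"
    and weight_le: "x \<in> G \<Longrightarrow> weight x \<le> 2 * s"
begin

lemma s_pos: "s > 0"
  using dim_eq by (cases s) simp_all

lemma sum_nonzeros_less: "(\<Sum>i<m. nonzeros i) < 2 * s * card G"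
proof -
  have "(\<Sum>x\<in>G. weight x) < (\<Sum>x\<in>G. 2 * s)"
  proof (rule sum_strict_mono_ex1)
    show "\<exists>x\<in>G. weight x < 2 * s"
      using zero_mem s_pos weight_eq_0_iff[OF zero_mem] by (intro bexI[of _ 0]) simp_all
  qed (use finite_group weight_le in auto)
  then show ?thesis
    by (simp add: sum_weight mult.commute)
qed

text \<open>A coordinate where 2x is nonzero is nonzero on two thirds of the group, a sixth above
  the guaranteed half. Three of them would use up 1/2, but the margin is strictly smaller. The
  factor 6 clears denominators.\<close>

lemma card_double_support_le_2:
  assumes "x \<in> G"
  shows "card {i \<in> {..<m}. x i + x i \<noteq> 0} \<le> 2"
proof -
  let ?D = "{i \<in> {..<m}. x i + x i \<noteq> 0}"
  have "(\<Sum>i<m. 3 * card G + (if i \<in> ?D then card G else 0)) \<le> (\<Sum>i<m. 6 * nonzeros i)"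
  proof (rule sum_mono)
    fix i assume "i \<in> {..<m}"
    then show "3 * card G + (if i \<in> ?D then card G else 0) \<le> 6 * nonzeros i"
      using two_nonzeros_ge[of i] three_nonzeros_ge[OF assms, of i] by auto
  qed
  moreover have "(\<Sum>i<m. if i \<in> ?D then card G else 0) = card ?D * card G"
    by (subst sum.inter_restrict[symmetric]) (auto simp: Int_def)
  ultimately have "m * (3 * card G) + card ?D * card G \<le> 6 * (\<Sum>i<m. nonzeros i)"
    by (simp add: sum.distrib sum_distrib_left)
  also have "\<dots> < 12 * s * card G"
    using sum_nonzeros_less by simp
  finally have "(3 * m + card ?D) * card G < (12 * s) * card G"
    by (simp add: algebra_simps)
  then have "3 * m + card ?D < 12 * s"
    by simp
  then show ?thesis
    using dim_eq s_pos by linarith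
qed

text \<open>If $2x \ne 0$, then $w = 2x$ has exactly two nonzero coordinates $i$ and $j$.  Either these have
  order $2$, and $\{0, x, 2x, 3x\}$ shows that the two coordinates are nonzero on three quarters of
  the group, or every coset of the multiples of $w$ contains an element nonzero at both $i$ and $j$, so
  that at most $2s - 2$ other coordinates can be nonzero.  Both contradict the averages.\<close>

lemma involution:
  assumes x: "x \<in> G" shows "x + x = 0"
proof (rule ccontr)
  assume nz: "x + x \<noteq> 0"
  define w where "w = x + x"
  have w: "w \<in> G" and w': "w \<noteq> 0"
    using x nz add_mem w_def by auto
  let ?D = "{i \<in> {..<m}. w i \<noteq> 0}"
  have "card ?D \<le> 2"
    using card_double_support_le_2[OF x] by (simp add: w_def)
  moreover have "card ?D \<noteq> 1"
    by (rule card_support_neq_1[OF w])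
  moreover have "card ?D \<noteq> 0"
    using weight_eq_0_iff[OF w] w' unfolding weight_def by blast
  ultimately have D2: "card ?D = 2"
    by linarith
  then obtain i j where ij: "?D = {i, j}" "i \<noteq> j"
    by (meson card_2_iff)
  have im: "i < m" "j < m" "w i \<noteq> 0" "w j \<noteq> 0"
    using ij by blast+
  have w0: "w l = 0" if "l \<notin> {i, j}" for l
    using that ij support_subset[OF w] by (metis (mono_tags, lifting) lessThan_iff mem_Collect_eq not_le)
  let ?I = "{..<m} - {i, j}"
  have split: "(\<Sum>l<m. nonzeros l) = nonzeros i + nonzeros j + (\<Sum>l\<in>?I. nonzeros l)"
  proof -
    have "{i, j} \<subseteq> {..<m}"
      using im by auto
    then have "(\<Sum>l<m. nonzeros l) = (\<Sum>l\<in>?I. nonzeros l) + (\<Sum>l\<in>{i, j}. nonzeros l)"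
      by (rule sum.subset_diff) simp
    then show ?thesis
      using ij by simp
  qed
  have cI: "card ?I = m - 2"
    using im ij by (subst card_Diff_subset) auto
  have "(\<Sum>l\<in>?I. card G) \<le> (\<Sum>l\<in>?I. 2 * nonzeros l)"
    by (intro sum_mono two_nonzeros_ge) auto
  then have rest: "(m - 2) * card G \<le> 2 * (\<Sum>l\<in>?I. nonzeros l)"
    using cI by (simp add: sum_distrib_left)
  show False
  proof (cases "w i + w i = 0 \<or> w j + w j = 0")
    \<comment> \<open>The support of \<open>w + w\<close> is then a proper subset of
      \<open>{i, j}\<close>, and it cannot have exactly one element, so it is empty.\<close>
    case True
    have ww: "w + w \<in> G"
      using w add_mem by blast
    have "card {l \<in> {..<m}. (w + w) l \<noteq> 0} = 0"
    proof -
      have "(w + w) l = 0" if "l \<notin> {i, j}" for l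
        using w0[OF that] by simp
      then have "{l \<in> {..<m}. (w + w) l \<noteq> 0} \<subseteq> {i, j}"
        by blast
      moreover have "{l \<in> {..<m}. (w + w) l \<noteq> 0} \<noteq> {i, j}"
        using True by auto
      ultimately have "{l \<in> {..<m}. (w + w) l \<noteq> 0} \<subset> {i, j}"
        by blast
      then have "card {l \<in> {..<m}. (w + w) l \<noteq> 0} < card {i, j}"
        by (intro psubset_card_mono) simp_all
      then have "card {l \<in> {..<m}. (w + w) l \<noteq> 0} < 2"
        using ij(2) by simp
      then show ?thesis
        using card_support_neq_1[OF ww] by (simp only: less_2_cases_iff One_nat_def) blast
    qed
    then have "w + w = 0"
      using weight_eq_0_iff[OF ww] weight_def by simp
    then have "w i + w i = 0" "w j + w j = 0"
      by (metis plus_fun_apply zero_fun_apply)+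
    then have "3 * card G \<le> 4 * nonzeros i" "3 * card G \<le> 4 * nonzeros j"
      using four_nonzeros_ge[OF x] im by (auto simp: w_def)
    then have "6 * card G + 2 * ((m - 2) * card G) \<le> 4 * (\<Sum>l<m. nonzeros l)"
      using rest split by linarith
    also have "\<dots> < 4 * (2 * s * card G)"
      using sum_nonzeros_less by simp
    finally have "(6 + 2 * (m - 2)) * card G < (8 * s) * card G"
      by (simp add: algebra_simps)
    then have "6 + 2 * (m - 2) < 8 * s"
      by simp
    then show False
      using dim_eq s_pos by linarith
  next
    case False
    have le: "card {l \<in> ?I. y l \<noteq> 0} + 2 \<le> 2 * s" if y: "y \<in> G" for y
    proof -
      \<comment> \<open>The three shifts have distinct values at \<open>i\<close> and at
        \<open>j\<close>, so each coordinate rules out at most one of them.\<close>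
      have "\<exists>z\<in>{0, w, w + w}. y i + z i \<noteq> 0 \<and> y j + z j \<noteq> 0"
      proof (rule ccontr)
        assume "\<not> ?thesis"
        then have "y i = 0 \<or> y j = 0" "y i + w i = 0 \<or> y j + w j = 0"
          "y i + (w i + w i) = 0 \<or> y j + (w j + w j) = 0"
          by auto
        then show False
          using False im by (metis add.left_neutral add.assoc add_left_cancel add.right_neutral)
      qed
      then obtain z where z: "z \<in> {0, w, w + w}" "y i + z i \<noteq> 0" "y j + z j \<noteq> 0"
        by blast
      have zG: "y + z \<in> G"
        using z y w zero_mem add_mem by blast
      have z0: "z l = 0" if "l \<notin> {i, j}" for l
        using z(1) w0[OF that] by auto
      have "{l \<in> {..<m}. (y + z) l \<noteq> 0} = {l \<in> ?I. y l \<noteq> 0} \<union> {i, j}"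
        using z im z0 by auto
      then have "weight (y + z) = card ({l \<in> ?I. y l \<noteq> 0} \<union> {i, j})"
        by (simp add: weight_def)
      also have "\<dots> = card {l \<in> ?I. y l \<noteq> 0} + 2"
        using ij by (subst card_Un_disjoint) auto
      finally show ?thesis
        using weight_le[OF zG] by simp
    qed
    have "(\<Sum>y\<in>G. card {l \<in> ?I. y l \<noteq> 0} + 2) \<le> (\<Sum>y\<in>G. 2 * s)"
      by (intro sum_mono le)
    then have "(\<Sum>y\<in>G. card {l \<in> ?I. y l \<noteq> 0}) + 2 * card G \<le> 2 * s * card G"
      by (simp only: sum.distrib sum_constant mult.commute of_nat_id)
    then have "(\<Sum>l\<in>?I. nonzeros l) + 2 * card G \<le> 2 * s * card G"
      by (subst sum_card_support[symmetric]) simp_all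
    then have "(m - 2) * card G + 4 * card G \<le> 4 * s * card G"
      using rest by linarith
    then have "(m - 2 + 4) * card G \<le> (4 * s) * card G"
      by (simp only: add_mult_distrib)
    \<comment> \<open>Impossible, since the left side is m + 2 = 4s + 1.\<close>
    then have "m - 2 + 4 \<le> 4 * s"
      using card_group_pos by simp
    then show False
      using dim_eq s_pos by linarith
  qed
qed

end

section \<open>The binary case: second moment and code structure\<close>

text \<open>The extra assumption abstracts that 1/2 is the only element of order two in the reals
  modulo the integers; coordinates thereby behave as bits.\<close>

locale extremal_binary_group = extremal_coordinate_group G m s
  for G :: "(nat \<Rightarrow> 'a::ab_group_add) set" and m s +
  assumes involution_unique:
    "\<And>a b :: 'a. a + a = 0 \<Longrightarrow> b + b = 0 \<Longrightarrow> a \<noteq> 0 \<Longrightarrow> b \<noteq> 0 \<Longrightarrow> a = b"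
begin

lemma coordinate_involution: "x \<in> G \<Longrightarrow> x i + x i = 0"
  using involution by (metis plus_fun_apply zero_fun_apply)

text \<open>Translation by \<open>g\<close> swaps kernel and complement, since two nonzero values of
  \<open>h\<close> coincide and cancel. Applied to coordinates and to differences of
  coordinates.\<close>

lemma card_hom_nonzero:
  assumes h: "\<And>x y. x \<in> G \<Longrightarrow> y \<in> G \<Longrightarrow> h (x + y) = h x + h y"
    and inv: "\<And>x. x \<in> G \<Longrightarrow> h x + h x = 0"
    and g: "g \<in> G" "h g \<noteq> 0"
  shows "2 * card {x \<in> G. h x \<noteq> (0::'a)} = card G"
proof -
  let ?Z = "{x \<in> G. h x = 0}" and ?N = "{x \<in> G. h x \<noteq> 0}"
  have inj: "inj_on ((+) g) A" for A
    by simp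
  have zero: "h g + h x = 0" if "x \<in> G" "h x \<noteq> 0" for x
    using involution_unique[OF inv[OF g(1)] inv[OF that(1)] g(2) that(2)] inv[OF that(1)] by simp
  have "(+) g ` ?Z \<subseteq> ?N" "(+) g ` ?N \<subseteq> ?Z"
    using g zero add_mem h by auto
  then have "card ?Z \<le> card ?N" "card ?N \<le> card ?Z"
    using card_inj_on_le[OF inj] finite_group by simp_all
  moreover have "card (?Z \<union> ?N) = card ?Z + card ?N"
    using finite_group by (intro card_Un_disjoint) auto
  moreover have "?Z \<union> ?N = G"
    by blast
  ultimately show ?thesis
    by simp
qed

lemma two_nonzeros: "i < m \<Longrightarrow> 2 * nonzeros i = card G"
  unfolding nonzeros_def using coordinate_nontrivial[of i] coordinate_involution
  by (auto intro: card_hom_nonzero)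

definition joint_nonzeros :: "nat \<Rightarrow> nat \<Rightarrow> nat" where
  "joint_nonzeros i j = card {x \<in> G. x i \<noteq> 0 \<and> x j \<noteq> 0}"

text \<open>Distinct coordinates are independent, giving a quarter of the group; equal ones,
  including \<open>i = j\<close>, give half. The link is that \<open>x i\<close> and
  \<open>x j\<close> differ exactly when just one of them is nonzero.\<close>

lemma four_joint_nonzeros:
  assumes ij: "i < m" "j < m"
  shows "4 * joint_nonzeros i j = (if \<exists>x\<in>G. x i \<noteq> x j then card G else 2 * card G)"
proof -
  let ?A = "{x \<in> G. x i \<noteq> 0 \<and> x j \<noteq> 0}" and ?B = "{x \<in> G. x i \<noteq> 0 \<and> x j = 0}"
    and ?C = "{x \<in> G. x i = 0 \<and> x j \<noteq> 0}"
  have "card (?A \<union> ?B) = card ?A + card ?B" "card (?A \<union> ?C) = card ?A + card ?C"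
    "card (?B \<union> ?C) = card ?B + card ?C"
    using finite_group by (intro card_Un_disjoint; auto)+
  moreover have "?A \<union> ?B = {x \<in> G. x i \<noteq> 0}" "?A \<union> ?C = {x \<in> G. x j \<noteq> 0}"
    by blast+
  moreover have "?B \<union> ?C = {x \<in> G. x i - x j \<noteq> 0}"
    using involution_unique[OF coordinate_involution coordinate_involution] by auto
  ultimately have eq: "nonzeros i + nonzeros j = 2 * card ?A + card {x \<in> G. x i - x j \<noteq> 0}"
    by (simp add: nonzeros_def)
  have "2 * card {x \<in> G. x i - x j \<noteq> 0} = (if \<exists>x\<in>G. x i \<noteq> x j then card G else 0)"
  proof (cases "\<exists>x\<in>G. x i \<noteq> x j")
    case True
    then obtain g where "g \<in> G" "g i \<noteq> g j"
      by blast
    moreover have "x i - x j + (x i - x j) = 0" if "x \<in> G" for x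
    proof -
      have "x i - x j + (x i - x j) = (x i + x i) - (x j + x j)"
        by (simp only: add_diff_add)
      then show ?thesis
        using that by (simp add: coordinate_involution)
    qed
    ultimately show ?thesis
      using True by (subst card_hom_nonzero[of "\<lambda>x. x i - x j" g]) auto
  next
    case False
    then have "{x \<in> G. x i - x j \<noteq> 0} = {}"
      by auto
    then show ?thesis
      using False by (simp only:) simp
  qed
  then show ?thesis
    using eq two_nonzeros[OF ij(1)] two_nonzeros[OF ij(2)] unfolding joint_nonzeros_def
    by (auto split: if_splits)
qed

lemma sum_weight_squared: "(\<Sum>x\<in>G. weight x ^ 2) = (\<Sum>i<m. \<Sum>j<m. joint_nonzeros i j)"
proof -
  have "(\<Sum>x\<in>G. weight x ^ 2) = (\<Sum>x\<in>G. \<Sum>i<m. \<Sum>j<m. if x i \<noteq> 0 \<and> x j \<noteq> 0 then 1 else 0)"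
  proof (rule sum.cong[OF refl])
    fix x assume "x \<in> G"
    have "weight x = (\<Sum>i<m. if x i \<noteq> 0 then 1 else 0)"
      by (simp add: weight_def sum.If_cases Int_def)
    then have "weight x ^ 2 = (\<Sum>i<m. \<Sum>j<m. (if x i \<noteq> 0 then 1 else 0) * (if x j \<noteq> 0 then 1 else 0))"
      by (simp only: power2_eq_square sum_product)
    also have "\<dots> = (\<Sum>i<m. \<Sum>j<m. if x i \<noteq> 0 \<and> x j \<noteq> 0 then 1 else 0)"
      by (intro sum.cong refl) simp
    finally show "weight x ^ 2 = (\<Sum>i<m. \<Sum>j<m. if x i \<noteq> 0 \<and> x j \<noteq> 0 then 1 else 0)" .
  qed
  also have "\<dots> = (\<Sum>i<m. \<Sum>x\<in>G. \<Sum>j<m. if x i \<noteq> 0 \<and> x j \<noteq> 0 then 1 else 0)"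
    by (rule sum.swap)
  also have "\<dots> = (\<Sum>i<m. \<Sum>j<m. \<Sum>x\<in>G. if x i \<noteq> 0 \<and> x j \<noteq> 0 then 1 else 0)"
    by (intro sum.cong refl sum.swap)
  also have "\<dots> = (\<Sum>i<m. \<Sum>j<m. joint_nonzeros i j)"
    using finite_group by (intro sum.cong refl) (simp add: joint_nonzeros_def sum.If_cases Int_def)
  finally show ?thesis .
qed

text \<open>Since every weight lies in $[0, 2s]$, the sum of $w (2s - w)$ over all weights $w$ is
  nonnegative.  The pairwise independence of distinct coordinates makes it vanish, and coinciding
  coordinates would make it negative.\<close>

lemma
  shows distinct_coordinates:
      "\<And>i j. i < m \<Longrightarrow> j < m \<Longrightarrow> i \<noteq> j \<Longrightarrow> \<exists>x\<in>G. x i \<noteq> x j"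
    and weight_eq: "\<And>x. x \<in> G \<Longrightarrow> x \<noteq> 0 \<Longrightarrow> weight x = 2 * s"
proof -
  \<comment> \<open>The excess caused by coinciding coordinates with different indices; the diagonal
    is accounted for separately.\<close>
  define e where "e i j = (if i \<noteq> j \<and> \<not> (\<exists>x\<in>G. x i \<noteq> x j) then card G else 0)" for i j :: nat
  let ?E = "\<Sum>i<m. \<Sum>j<m. e i j"
  let ?S = "\<Sum>x\<in>G. weight x * (2 * s - weight x)"
  have "4 * (\<Sum>x\<in>G. weight x ^ 2) = (\<Sum>i<m. \<Sum>j<m. 4 * joint_nonzeros i j)"
    by (simp only: sum_weight_squared sum_distrib_left)
  also have "\<dots> = (\<Sum>i<m. \<Sum>j<m. card G + (if i = j then card G else 0) + e i j)"
    by (intro sum.cong refl) (auto simp: four_joint_nonzeros e_def)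
  also have "\<dots> = m * (m * card G) + m * card G + ?E"
    by (simp add: sum.distrib distrib_left)
  finally have sq: "4 * (\<Sum>x\<in>G. weight x ^ 2) = (m + 1) * m * card G + ?E"
    by (simp add: algebra_simps)
  have "4 * (2 * s * (\<Sum>x\<in>G. weight x)) = 4 * s * (\<Sum>i<m. 2 * nonzeros i)"
    by (simp only: sum_weight sum_distrib_left[symmetric])
  also have "\<dots> = 4 * s * (m * card G)"
    using two_nonzeros by simp
  finally have lin: "4 * (2 * s * (\<Sum>x\<in>G. weight x)) = 4 * s * (m * card G)" .
  have "?S + (\<Sum>x\<in>G. weight x ^ 2) = (\<Sum>x\<in>G. 2 * s * weight x)"
  proof (subst sum.distrib[symmetric], rule sum.cong[OF refl])
    fix x assume "x \<in> G"
    have "weight x * (2 * s - weight x) + weight x ^ 2 = weight x * (2 * s - weight x + weight x)"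
      by (simp only: power2_eq_square distrib_left)
    then show "weight x * (2 * s - weight x) + weight x ^ 2 = 2 * s * weight x"
      using weight_le[OF \<open>x \<in> G\<close>] by (simp add: mult.commute)
  qed
  then have "4 * ?S + 4 * (\<Sum>x\<in>G. weight x ^ 2) = 4 * s * (m * card G)"
    using lin by (simp only: sum_distrib_left[symmetric])
  \<comment> \<open>The main terms cancel because m + 1 = 4s. Over the natural numbers both summands
    then vanish; the subtraction in \<open>?S\<close> is exact by \<open>weight_le\<close>.\<close>
  then have "4 * ?S + ?E = 0"
    using sq unfolding dim_eq by (simp only: mult.assoc)
  then have S0: "?S = 0" and E0: "?E = 0"
    by linarith+
  show "\<exists>x\<in>G. x i \<noteq> x j" if "i < m" "j < m" "i \<noteq> j" for i j
  proof -
    have "e i j = 0"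
      using E0 that by simp
    then show ?thesis
      using that(3) card_group_pos by (auto simp: e_def split: if_splits)
  qed
  show "weight x = 2 * s" if "x \<in> G" "x \<noteq> 0" for x
  proof -
    have "weight x * (2 * s - weight x) = 0"
      using S0 finite_group that(1) by simp
    then show ?thesis
      using that weight_le[of x] weight_eq_0_iff[of x] by auto
  qed
qed

text \<open>The total weight is 2s(|G| - 1) by elements and m|G|/2 by coordinates; with m = 4s - 1
  this forces |G| = 4s.\<close>

lemma card_group: "card G = 4 * s"
proof -
  have m: "m = 4 * s - 1"
    using dim_eq by simp
  have "(\<Sum>x\<in>G. weight x) = (\<Sum>x\<in>G - {0}. 2 * s)"
  proof -
    have "(\<Sum>x\<in>G. weight x) = weight 0 + (\<Sum>x\<in>G - {0}. weight x)"
      using zero_mem finite_group by (rule sum.remove[rotated])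
    also have "(\<Sum>x\<in>G - {0}. weight x) = (\<Sum>x\<in>G - {0}. 2 * s)"
      by (intro sum.cong refl weight_eq) auto
    also have "weight 0 = 0"
      using weight_eq_0_iff[OF zero_mem] by blast
    finally show ?thesis
      by (simp only: add_0)
  qed
  also have "\<dots> = 2 * s * (card G - 1)"
    using zero_mem finite_group by simp
  finally have w: "(\<Sum>x\<in>G. weight x) = 2 * s * (card G - 1)" .
  have "2 * (\<Sum>x\<in>G. weight x) = (\<Sum>i<m. 2 * nonzeros i)"
    by (simp only: sum_weight sum_distrib_left)
  also have "\<dots> = m * card G"
    using two_nonzeros by simp
  finally have "4 * s * (card G - 1) = m * card G"
    using w m by simp
  then have "4 * s * card G - 4 * s = 4 * s * card G - card G"
    by (simp only: m diff_mult_distrib diff_mult_distrib2 mult_1 mult_1_right)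
  moreover have "4 * s \<le> 4 * s * card G" "card G \<le> 4 * s * card G"
    using card_group_pos s_pos by auto
  ultimately show ?thesis
    by linarith
qed

text \<open>Coordinates that agree or vanish on the generators do so on all of \<open>G\<close>, so
  the columns are distinct and nonzero; as m is 2^k - 1, none is missing.\<close>

lemma simplex_code_structure:
  obtains k gs where "4 * s = 2 ^ k" "length gs = k" "group_closure (set gs) = G"
    "bij_betw (\<lambda>j. map (\<lambda>g. if g j = 0 then 0 else 1) gs) {..<m}
       {c :: bit list. length c = k \<and> c \<noteq> replicate k 0}"
proof -
  obtain gs where gs: "set gs \<subseteq> G" "group_closure (set gs) = G" "card G = 2 ^ length gs"
    using involutive_group_generators[OF finite_group zero_mem diff_mem involution] by blast
  define col where "col j = map (\<lambda>g. if g j = 0 then 0 else 1 :: bit) gs" for j :: nat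
  let ?C = "{c :: bit list. length c = length gs \<and> c \<noteq> replicate (length gs) 0}"
  have inj: "inj_on col {..<m}"
  proof (rule inj_onI, rule ccontr)
    fix i j assume ij: "i \<in> {..<m}" "j \<in> {..<m}" "col i = col j" "i \<noteq> j"
    have gen: "g i = g j" if "g \<in> set gs" for g
    proof -
      have "g i = 0 \<longleftrightarrow> g j = 0"
        using ij(3) that by (auto simp: col_def split: if_splits)
      then show ?thesis
        using involution_unique[of "g i" "g j"] coordinate_involution gs(1) that by auto
    qed
    have "x i = x j" if "x \<in> G" for x
      using that unfolding gs(2)[symmetric]
      by induction (auto simp: gen)
    then show False
      using distinct_coordinates[of i j] ij by auto
  qed
  have "col j \<noteq> replicate (length gs) 0" if "j < m" for j
  proof
    assume "col j = replicate (length gs) 0"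
    then have "set (col j) \<subseteq> {0}"
      by (simp add: set_replicate_conv_if)
    then have gen: "g j = 0" if "g \<in> set gs" for g
      using that by (auto simp: col_def split: if_splits)
    have "x j = 0" if "x \<in> G" for x
      using that unfolding gs(2)[symmetric]
      by induction (auto simp: gen)
    then show False
      using coordinate_nontrivial[OF \<open>j < m\<close>] by blast
  qed
  then have sub: "col ` {..<m} \<subseteq> ?C"
    by (auto simp: col_def)
  have "card (col ` {..<m}) = card ?C"
    using card_image[OF inj] gs(3) card_group dim_eq by (simp add: card_nonzero_bit_lists)
  then have "col ` {..<m} = ?C"
    using sub finite_nonzero_bit_lists by (simp add: card_subset_eq)
  then have "bij_betw col {..<m} ?C"
    using inj by (simp add: bij_betw_def)
  then show thesis
    using that[of "length gs" gs] gs card_group by (simp add: col_def[abs_def])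
qed

end

section \<open>Simplices of maximal dimension\<close>

lemma vertex_ordering_simplex:
  fixes \<Delta> :: "(real ^ 'n) set"
  assumes \<Delta>: "lattice_simplex \<Delta>" and vs: "vertex_ordering \<Delta> vs"
  shows "lattice_simplex_vertices vs" and "convex hull (set vs) = \<Delta>"
proof -
  obtain C where C: "\<not> affine_dependent C" "int (card C) = int CARD('n) + 1" "\<Delta> = convex hull C"
    using \<Delta> by (auto simp: lattice_simplex_def simplex_def)
  have set_vs: "set vs = C"
    using vs C by (auto simp: vertex_ordering_def extreme_point_of_convex_hull_affine_independent)
  show "convex hull (set vs) = \<Delta>"
    using set_vs C by simp
  show "lattice_simplex_vertices vs"
  proof
    show dist: "distinct vs"
      using vs by (simp add: vertex_ordering_def)
    show "\<not> affine_dependent (set vs)"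
      using C set_vs by simp
    show "length vs = CARD('n) + 1"
      using C(2) distinct_card[OF dist] by (simp add: set_vs)
    show "set vs \<subseteq> integer_lattice"
      using \<Delta> vs by (auto simp: lattice_simplex_def lattice_polytope_def vertex_ordering_def)
  qed
qed

lemma vertex_ordering_exists:
  assumes "lattice_simplex \<Delta>"
  obtains vs where "vertex_ordering \<Delta> vs"
proof -
  obtain C where "\<not> affine_dependent C" "\<Delta> = convex hull C"
    using assms by (auto simp: lattice_simplex_def simplex_def)
  then have "{v. v extreme_point_of \<Delta>} = C" "finite C"
    by (auto simp: extreme_point_of_convex_hull_affine_independent aff_independent_finite)
  then show thesis
    using finite_distinct_list[of C] that by (auto simp: vertex_ordering_def)
qed

lemma unimodularly_equivalent_if_same_group:
  fixes \<Delta> \<Delta>' :: "(real ^ 'n) set"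
  assumes "lattice_simplex \<Delta>" "vertex_ordering \<Delta> vs"
    and "lattice_simplex \<Delta>'" "vertex_ordering \<Delta>' ws"
    and "simplex_group vs = simplex_group ws"
  shows "unimodularly_equivalent \<Delta> \<Delta>'"
  using unimodularly_equivalent_if_simplex_group_eq[of vs ws] assms
    vertex_ordering_simplex[of \<Delta> vs] vertex_ordering_simplex[of \<Delta>' ws] by simp

text \<open>Entry \<open>i\<close> of the permuted list is \<open>vs ! \<tau> i\<close>, so
  coordinates are composed with \<open>\<tau>\<close> itself. It fixes indices beyond the list,
  which preserves the zero tail.\<close>

lemma simplex_group_permute_list:
  fixes vs :: "(real ^ 'n) list"
  assumes \<tau>: "\<tau> permutes {..<length vs}"
  shows "simplex_group (permute_list \<tau> vs) = (\<lambda>a. a \<circ> \<tau>) ` simplex_group vs"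
proof -
  let ?P = "\<lambda>ws x. (\<forall>i\<ge>length ws. x i = 0) \<and> (\<Sum>i<length ws. x i *\<^sub>R ws ! i) \<in> integer_lattice \<and>
    (\<Sum>i<length ws. x i) \<in> \<int>"
  have sums: "(\<Sum>i<length vs. x (\<tau> i) *\<^sub>R permute_list \<tau> vs ! i) = (\<Sum>i<length vs. x i *\<^sub>R vs ! i)"
    "(\<Sum>i<length vs. x (\<tau> i)) = (\<Sum>i<length vs. x i)" for x
    using sum.permute[OF \<tau>, of "\<lambda>i. x i *\<^sub>R vs ! i"] sum.permute[OF \<tau>, of x]
    by (simp_all add: permute_list_nth[OF \<tau>])
  have out: "(\<forall>i\<ge>length vs. x (\<tau> i) = 0) \<longleftrightarrow> (\<forall>i\<ge>length vs. x i = 0)" for x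
    using permutes_not_in[OF \<tau>] by auto
  have P: "?P (permute_list \<tau> vs) (x \<circ> \<tau>) \<longleftrightarrow> ?P vs x" for x
    using sums[of x] out[of x] by simp
  show ?thesis
  proof (intro antisym subsetI)
    fix a assume "a \<in> simplex_group (permute_list \<tau> vs)"
    then obtain x where x: "a = (\<lambda>i. real_class (x i))" "?P (permute_list \<tau> vs) x"
      unfolding simplex_group_def by blast
    define y where "y = x \<circ> inv \<tau>"
    have xy: "x = y \<circ> \<tau>"
      by (simp add: y_def comp_assoc permutes_inv_o[OF \<tau>])
    have "?P vs y"
      using x(2) unfolding xy P .
    then have "(\<lambda>i. real_class (y i)) \<in> simplex_group vs"
      unfolding simplex_group_def by blast
    moreover have "a = (\<lambda>i. real_class (y i)) \<circ> \<tau>"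
      by (simp add: x(1) xy comp_def)
    ultimately show "a \<in> (\<lambda>a. a \<circ> \<tau>) ` simplex_group vs"
      by blast
  next
    fix a assume "a \<in> (\<lambda>a. a \<circ> \<tau>) ` simplex_group vs"
    then obtain y where y: "a = (\<lambda>i. real_class (y i)) \<circ> \<tau>" "?P vs y"
      unfolding simplex_group_def by blast
    have "?P (permute_list \<tau> vs) (y \<circ> \<tau>)"
      using y(2) unfolding P .
    moreover have "a = (\<lambda>i. real_class ((y \<circ> \<tau>) i))"
      by (simp add: y(1) comp_def)
    ultimately show "a \<in> simplex_group (permute_list \<tau> vs)"
      unfolding simplex_group_def by blast
  qed
qed

lemma double_eq_0_imp_half:
  fixes a :: real_mod_int
  assumes "a + a = 0" "a \<noteq> 0"
  shows "a = real_class (1 / 2)"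
proof -
  obtain x where x: "a = real_class x"
    by (rule real_class_surj)
  have "x + x \<in> \<int>" and nint: "x \<notin> \<int>"
    using assms by (simp_all add: x real_class_eq_0_iff flip: real_class_add)
  then obtain n where n: "x + x = of_int n"
    by (auto elim: Ints_cases)
  have "odd n"
  proof
    assume "even n"
    then obtain k where "n = 2 * k"
      by blast
    then have "x = of_int k"
      using n by simp
    then show False
      using nint by simp
  qed
  then obtain k where "n = 2 * k + 1"
    by (rule oddE)
  then have "x - 1 / 2 = of_int k"
    using n by simp
  then show ?thesis
    by (simp add: x real_class_eq_iff)
qed

text \<open>Holding for every matrix \<open>A\<close>, it allows two simplices to be ordered so as
  to have literally the same group.\<close>

lemma code_ordering_exists:
  fixes \<Delta> :: "(real ^ 'n) set"
  assumes dim: "CARD('n) = 4 * s - 2" and s: "s > 0"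
    and \<Delta>: "lattice_simplex \<Delta>" "polytope_degree \<Delta> = s" "\<not> is_lattice_pyramid \<Delta>"
  obtains r where "s = 2 ^ r"
    "\<And>A. simplex_code_matrix (r + 2) A \<Longrightarrow>
      \<exists>vs. vertex_ordering \<Delta> vs \<and> simplex_group vs = simplex_code_group (r + 2) A"
proof -
  obtain vs where vs: "vertex_ordering \<Delta> vs"
    using vertex_ordering_exists[OF \<Delta>(1)] .
  interpret lattice_simplex_vertices vs
    by (rule vertex_ordering_simplex[OF \<Delta>(1) vs])
  have hull: "convex hull (set vs) = \<Delta>"
    by (rule vertex_ordering_simplex[OF \<Delta>(1) vs])
  let ?G = "simplex_group vs" and ?m = "length vs"
  \<comment> \<open>Interpreted in two stages, since the weight bound below uses
    \<open>C.weight\<close> and closure under negation.\<close>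
  interpret C: coordinate_group ?G ?m
  proof
    show "\<exists>a\<in>?G. a i \<noteq> 0" if "i < ?m" for i
      using pyramid_if_trivial_coordinate[OF that] \<Delta>(3) hull by auto
  qed (simp_all only: finite_simplex_group zero_mem_simplex_group diff_mem_simplex_group
      simplex_group_outside card_support_simplex_group not_False_eq_True)
  interpret C: extremal_binary_group ?G ?m s
  proof
    show "?m + 1 = 4 * s"
      using length_vertices dim s by simp
    show "C.weight a \<le> 2 * s" if "a \<in> ?G" for a
      using height_add_height_uminus[OF that] height_le_degree[OF that]
        height_le_degree[OF C.uminus_mem[OF that]] by (simp add: C.weight_def hull \<Delta>(2))
    show "a = b" if "a + a = 0" "b + b = 0" "a \<noteq> 0" "b \<noteq> 0" for a b :: real_mod_int
      using double_eq_0_imp_half that by metis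
  qed
  obtain k gs where gs: "4 * s = 2 ^ k" "length gs = k" "group_closure (set gs) = ?G"
    and col: "bij_betw (\<lambda>j. map (\<lambda>g. if g j = 0 then 0 else 1) gs) {..<?m}
       {c :: bit list. length c = k \<and> c \<noteq> replicate k 0}"
    using C.simplex_code_structure by blast
  have "2 ^ 2 \<le> (2::nat) ^ k"
    using s gs(1) by simp
  then have "2 \<le> k"
    by (rule power_le_imp_le_exp[rotated]) simp
  then obtain r where r: "k = r + 2"
    by (metis add.commute le_Suc_ex)
  have "s = 2 ^ r"
    using gs(1) by (simp add: r)
  moreover have "\<exists>vs. vertex_ordering \<Delta> vs \<and> simplex_group vs = simplex_code_group (r + 2) A"
    if A: "simplex_code_matrix (r + 2) A" for A
  proof -
    let ?c = "\<lambda>j. map (\<lambda>g. if g j = 0 then 0 else 1 :: bit) gs"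
    let ?d = "\<lambda>j. map (\<lambda>i. A i j) [0..<k]"
    have m: "2 ^ k - 1 = ?m"
      using gs(1) C.dim_eq by simp
    have d: "bij_betw ?d {..<?m} {c. length c = k \<and> c \<noteq> replicate k 0}"
      using A unfolding simplex_code_matrix_def r[symmetric] m .
    \<comment> \<open>Sends \<open>j\<close> to the coordinate whose generator column equals column
      \<open>j\<close> of \<open>A\<close>; both families list all nonzero bit vectors.\<close>
    define \<tau> where "\<tau> j = (if j \<in> {..<?m} then (inv_into {..<?m} ?c \<circ> ?d) j else j)" for j
    have "bij_betw (inv_into {..<?m} ?c \<circ> ?d) {..<?m} {..<?m}"
      using d bij_betw_inv_into[OF col] by (rule bij_betw_trans)
    then have "bij_betw \<tau> {..<?m} {..<?m}"
      by (subst bij_betw_cong[where g = "inv_into {..<?m} ?c \<circ> ?d"]) (simp add: \<tau>_def)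
    then have \<tau>: "\<tau> permutes {..<?m}"
      by (rule bij_imp_permutes) (simp add: \<tau>_def)
    have col_\<tau>: "?c (\<tau> j) = ?d j" if "j < ?m" for j
      using bij_betw_inv_into_right[OF col, of "?d j"] bij_betwE[OF d] that by (auto simp: \<tau>_def)
    have row: "gs ! i \<circ> \<tau> = half_row k A i" if i: "i < k" for i
    proof
      fix j
      have mem: "gs ! i \<in> ?G"
        using i gs(2) group_closure.base[of "gs ! i" "set gs"] by (simp add: gs(3))
      show "(gs ! i \<circ> \<tau>) j = half_row k A i j"
      proof (cases "j < ?m")
        case True
        have "?c (\<tau> j) ! i = ?d j ! i"
          by (simp only: col_\<tau>[OF True])
        then have "(if (gs ! i) (\<tau> j) = 0 then 0 else 1) = A i j"
          using i gs(2) by simp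
        then show ?thesis
          using True double_eq_0_imp_half[OF C.coordinate_involution[OF mem]]
          by (auto simp: half_row_def m[simplified] split: if_splits)
      next
        case False
        then show ?thesis
          using simplex_group_outside[OF mem] by (simp add: \<tau>_def half_row_def m[simplified])
      qed
    qed
    have "simplex_group (permute_list \<tau> vs) = (\<lambda>a. a \<circ> \<tau>) ` group_closure (set gs)"
      by (simp only: simplex_group_permute_list[OF \<tau>] gs(3))
    also have "\<dots> = group_closure ((\<lambda>a. a \<circ> \<tau>) ` set gs)"
      by (rule image_group_closure) (simp add: fun_eq_iff)
    also have "set gs = (!) gs ` {..<k}"
      using gs(2) by (auto simp: set_conv_nth)
    also have "(\<lambda>a. a \<circ> \<tau>) ` (!) gs ` {..<k} = half_row k A ` {..<k}"
      unfolding image_image by (rule image_cong) (simp_all only: row lessThan_iff)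
    finally have "simplex_group (permute_list \<tau> vs) = simplex_code_group (r + 2) A"
      by (simp add: simplex_code_group_def r)
    moreover have "vertex_ordering \<Delta> (permute_list \<tau> vs)"
      using vs \<tau> by (simp add: vertex_ordering_def)
    ultimately show ?thesis
      by blast
  qed
  ultimately show thesis
    by (rule that)
qed

theorem theorem1p3:
  fixes s :: nat and \<Delta> :: "(real ^ 'n) set"
  assumes "s > 0"
    and "CARD('n) = 4 * s - 2"
    and "lattice_simplex \<Delta>"
    and "polytope_degree \<Delta> = s"
    and "\<not> is_lattice_pyramid \<Delta>"
  shows "\<exists>r :: nat. s = 2 ^ r \<and>
     (\<exists>D :: (real ^ 'n) set. is_code_simplex (r + 2) D) \<and>
     (\<forall>D :: (real ^ 'n) set. is_code_simplex (r + 2) D \<longrightarrow> unimodularly_equivalent \<Delta> D) \<and>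
     (\<forall>A. simplex_code_matrix (r + 2) A \<longrightarrow>
        (\<exists>vs. vertex_ordering \<Delta> vs \<and> simplex_group vs = simplex_code_group (r + 2) A)) \<and>
     (\<forall>\<Delta>' :: (real ^ 'n) set.
        lattice_simplex \<Delta>' \<and> polytope_degree \<Delta>' = s \<and> \<not> is_lattice_pyramid \<Delta>' \<longrightarrow>
        unimodularly_equivalent \<Delta> \<Delta>')"
proof -
  obtain r where r: "s = 2 ^ r"
    and ordering: "\<And>A. simplex_code_matrix (r + 2) A \<Longrightarrow>
      \<exists>vs. vertex_ordering \<Delta> vs \<and> simplex_group vs = simplex_code_group (r + 2) A"
    using code_ordering_exists[OF assms(2,1,3-5)] by blast
  obtain A where A: "simplex_code_matrix (r + 2) A"
    using simplex_code_matrix_exists by blast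
  \<comment> \<open>The simplex is itself the required witness, as 4s - 2 equals 2^(r+2) -
    2.\<close>
  have "is_code_simplex (r + 2) \<Delta>"
    using assms(2,3) ordering[OF A] A by (auto simp: is_code_simplex_def r power_add)
  \<comment> \<open>The vertices of \<Delta> are ordered according to the matrix that comes with
    \<open>D\<close>.\<close>
  moreover have "unimodularly_equivalent \<Delta> D" if "is_code_simplex (r + 2) D" for D
    using that ordering unimodularly_equivalent_if_same_group[OF assms(3)]
    unfolding is_code_simplex_def by metis
  moreover have "unimodularly_equivalent \<Delta> \<Delta>'"
    if \<Delta>': "lattice_simplex \<Delta>'" "polytope_degree \<Delta>' = s" "\<not> is_lattice_pyramid \<Delta>'" for \<Delta>' :: "(real ^ 'n) set"
  proof -
    obtain r' where "s = 2 ^ r'" and ordering': "\<And>A. simplex_code_matrix (r' + 2) A \<Longrightarrow>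
        \<exists>vs. vertex_ordering \<Delta>' vs \<and> simplex_group vs = simplex_code_group (r' + 2) A"
      using code_ordering_exists[OF assms(2,1) \<Delta>'] by blast
    then have "r' = r"
      using r by simp
    then show ?thesis
      using ordering[OF A] ordering'[of A] A
        unimodularly_equivalent_if_same_group[OF assms(3) _ \<Delta>'(1)] by metis
  qed
  ultimately show ?thesis
    using r ordering by blast
qed

end
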